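(* The following relations hold between compact symmetric triads at the Lie algebra level: (1) $(\mathfrak{so}(8),\mathfrak u(4),\mathfrak{so}(4)\oplus\mathfrak{so}(4))\sim(\mathfrak{so}(8),\mathfrak{so}(2)\oplus\mathfrak{so}(6),\mathfrak{so}(4)\oplus\mathfrak{so}(4))$. (2) $(\mathfrak{so}(5),\mathfrak{so}(1)\oplus\mathfrak{so}(4),\mathfrak{so}(2)\oplus\mathfrak{so}(3))\sim(\mathfrak{sp}(2),\mathfrak{sp}(1)\oplus\mathfrak{sp}(1),\mathfrak u(2))$. (3) $(\mathfrak{su}(4),\mathfrak{so}(4),\mathfrak{sp}(2))\sim(\mathfrak{so}(6),\mathfrak{so}(3)\oplus\mathfrak{so}(3),\mathfrak{so}(1)\oplus\mathfrak{so}(5))$. (4) $(\mathfrak{su}(4),\mathfrak{so}(4),\mathfrak s(\mathfrak u(2)\oplus\mathfrak u(2)))\sim(\mathfrak{so}(6),\mathfrak{so}(3)\oplus\mathfrak{so}(3),\mathfrak{so}(2)\oplus\mathfrak{so}(4))$. (5) $(\mathfrak{su}(4),\mathfrak{so}(4),\mathfrak s(\mathfrak u(1)\oplus\mathfrak u(3)))\sim(\mathfrak{so}(6),\mathfrak{so}(3)\oplus\mathfrak{so}(3),\mathfrak u(3))$. (6) $(\mathfrak{su}(4),\mathfrak{sp}(2),\mathfrak s(\mathfrak u(2)\oplus\mathfrak u(2)))\sim(\mathfrak{so}(6),\mathfrak{so}(1)\oplus\mathfrak{so}(5),\mathfrak{so}(2)\oplus\mathfrak{so}(4))$. (7) $(\mathfrak{su}(4),\mathfrak{sp}(2),\mathfrak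 s(\mathfrak u(1)\oplus\mathfrak u(3)))\sim(\mathfrak{so}(6),\mathfrak{so}(1)\oplus\mathfrak{so}(5),\mathfrak u(3))$. (8) $(\mathfrak{su}(4),\mathfrak s(\mathfrak u(2)\oplus\mathfrak u(2)),\mathfrak s(\mathfrak u(1)\oplus\mathfrak u(3)))\sim(\mathfrak{so}(6),\mathfrak{so}(2)\oplus\mathfrak{so}(4),\mathfrak u(3))$.
   Context: A compact symmetric triad $(\mathfrak g,\theta_1,\theta_2)$ at the Lie algebra level is a compact semisimple Lie algebra with two involutions (automorphisms of order two). $(\mathfrak g,\theta_1,\theta_2)\sim(\mathfrak g,\theta_1',\theta_2')$ if there are $\varphi\in\mathrm{Aut}(\mathfrak g)$ and an inner automorphism $\tau\in\mathrm{Int}(\mathfrak g)$ with $\theta_1'=\varphi\theta_1\varphi^{-1}$ and $\theta_2'=\tau\varphi\theta_2\varphi^{-1}\tau^{-1}$. For triads on two isomorphic Lie algebras $\mathfrak g\simeq\mathfrak g'$, $(\mathfrak g,\theta_1,\theta_2)\sim(\mathfrak g',\theta_1',\theta_2')$ means the same with $\varphi:\mathfrak g\to\mathfrak g'$ a Lie algebra isomorphism and $\tau\in\mathrm{Int}(\mathfrak g')$. The symbol $(\mathfrak g,\mathfrak k_1,\mathfrak k_2)$ denotes a triad $(\mathfrak g,\theta_1,\theta_2)$ in which the fixed point subalgebra of $\theta_i$ is isomorphic to $\mathfrak k_i$ in the standard way: $\mathfrak{so}(n)\subset\mathfrak{su}(n)$ is fixed by $Z\mapsto\bar Z$; $\mathfrak{sp}(n)\subset\mathfrak{su}(2n)$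 by $Z\mapsto J_n\bar ZJ_n^{-1}$; $\mathfrak s(\mathfrak u(a)\oplus\mathfrak u(b))$, $\mathfrak{so}(a)\oplus\mathfrak{so}(b)$ and $\mathfrak{sp}(a)\oplus\mathfrak{sp}(b)$ are the block-diagonal subalgebras fixed by conjugation by $\mathrm{diag}(I_a,-I_b)$ (in $\mathfrak{su}(a+b)$, $\mathfrak{so}(a+b)$ and quaternionic $\mathfrak{sp}(a+b)$); $\mathfrak u(n)\subset\mathfrak{so}(2n)$ is fixed by conjugation by $J_n=\begin{pmatrix} O & -I_n \\ I_n & O \end{pmatrix}$; $\mathfrak u(n)\subset\mathfrak{sp}(n)$ is the standard symmetric subalgebra. In all the cases occurring here the class of the triad depends only on the isomorphism types of $\mathfrak k_1,\mathfrak k_2$. *)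

theory Defs
  imports "HOL-Analysis.Analysis"
begin

section \<open>Real Lie algebras and their automorphisms\<close>

text \<open>A finite-dimensional real Lie algebra is carried by a linear subspace of an ambient Euclidean
  space.  Only the behaviour of brackets and maps on the carriers is relevant.\<close>

record 'a lie_alg =
  carrier :: "'a set"
  bracket :: "'a \<Rightarrow> 'a \<Rightarrow> 'a"

definition lie_algebra :: "'a::euclidean_space lie_alg \<Rightarrow> bool" where
  "lie_algebra g \<longleftrightarrow>
     subspace (carrier g) \<and>
     (\<forall>x\<in>carrier g. \<forall>y\<in>carrier g. bracket g x y \<in> carrier g) \<and>
     (\<forall>x\<in>carrier g. \<forall>y\<in>carrier g. \<forall>z\<in>carrier g. \<forall>a b.
        bracket g (a *\<^sub>R x + b *\<^sub>R y) z = a *\<^sub>R bracket g x z + b *\<^sub>R bracket g y z \<and>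
        bracket g z (a *\<^sub>R x + b *\<^sub>R y) = a *\<^sub>R bracket g z x + b *\<^sub>R bracket g z y) \<and>
     (\<forall>x\<in>carrier g. bracket g x x = 0) \<and>
     (\<forall>x\<in>carrier g. \<forall>y\<in>carrier g. \<forall>z\<in>carrier g.
        bracket g x (bracket g y z) + bracket g y (bracket g z x) + bracket g z (bracket g x y) = 0)"

definition lie_iso :: "'a::euclidean_space lie_alg \<Rightarrow> 'b::euclidean_space lie_alg \<Rightarrow> ('a \<Rightarrow> 'b) \<Rightarrow> bool"
  where
  "lie_iso g h f \<longleftrightarrow>
     bij_betw f (carrier g) (carrier h) \<and>
     (\<forall>x\<in>carrier g. \<forall>y\<in>carrier g. f (x + y) = f x + f y) \<and>
     (\<forall>x\<in>carrier g. \<forall>a. f (a *\<^sub>R x) = a *\<^sub>R f x) \<and>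
     (\<forall>x\<in>carrier g. \<forall>y\<in>carrier g. f (bracket g x y) = bracket h (f x) (f y))"

abbreviation lie_aut :: "'a::euclidean_space lie_alg \<Rightarrow> ('a \<Rightarrow> 'a) \<Rightarrow> bool" where
  "lie_aut g \<equiv> lie_iso g g"

text \<open>Involutions have order exactly two, so the identity is excluded.\<close>

definition lie_involution :: "'a::euclidean_space lie_alg \<Rightarrow> ('a \<Rightarrow> 'a) \<Rightarrow> bool" where
  "lie_involution g \<theta> \<longleftrightarrow>
     lie_aut g \<theta> \<and> (\<forall>x\<in>carrier g. \<theta> (\<theta> x) = x) \<and> (\<exists>x\<in>carrier g. \<theta> x \<noteq> x)"

definition exp_ad :: "'a::euclidean_space lie_alg \<Rightarrow> 'a \<Rightarrow> 'a \<Rightarrow> 'a" where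
  "exp_ad g x y = (\<Sum>n. (1 / fact n) *\<^sub>R (bracket g x ^^ n) y)"

text \<open>The group of inner automorphisms is the one generated by all \<open>exp (ad x)\<close>.  No closure under
  inverses is needed, since \<open>exp (ad x)\<close> has the inverse \<open>exp (ad (- x))\<close>.\<close>

inductive_set Int_group :: "'a::euclidean_space lie_alg \<Rightarrow> ('a \<Rightarrow> 'a) set"
  for g :: "'a::euclidean_space lie_alg" where
  id: "id \<in> Int_group g"
| exp_ad: "x \<in> carrier g \<Longrightarrow> \<tau> \<in> Int_group g \<Longrightarrow> exp_ad g x \<circ> \<tau> \<in> Int_group g"

text \<open>The trace of an endomorphism \<open>f\<close> of a subspace \<open>V\<close>; its value does not depend on the chosen
  basis of \<open>V\<close>.\<close>

definition trace_on :: "'a::euclidean_space set \<Rightarrow> ('a \<Rightarrow> 'a) \<Rightarrow> real" where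
  "trace_on V f =
     (let B = (SOME B. independent B \<and> span B = V) in \<Sum>b\<in>B. representation B (f b) b)"

definition killing_form :: "'a::euclidean_space lie_alg \<Rightarrow> 'a \<Rightarrow> 'a \<Rightarrow> real" where
  "killing_form g x y = trace_on (carrier g) (bracket g x \<circ> bracket g y)"

text \<open>A real Lie algebra is compact semisimple if its Killing form is negative definite.\<close>

definition compact_semisimple :: "'a::euclidean_space lie_alg \<Rightarrow> bool" where
  "compact_semisimple g \<longleftrightarrow>
     lie_algebra g \<and> (\<forall>x\<in>carrier g. x \<noteq> 0 \<longrightarrow> killing_form g x x < 0)"


section \<open>Compact symmetric triads\<close>

type_synonym 'a triad = "'a lie_alg \<times> ('a \<Rightarrow> 'a) \<times> ('a \<Rightarrow> 'a)"

definition compact_symmetric_triad :: "'a::euclidean_space triad \<Rightarrow> bool" where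
  "compact_symmetric_triad = (\<lambda>(g, \<theta>\<^sub>1, \<theta>\<^sub>2).
     compact_semisimple g \<and> lie_involution g \<theta>\<^sub>1 \<and> lie_involution g \<theta>\<^sub>2)"

text \<open>The equivalence relates compact symmetric triads only.  The inverses are taken on the carriers.\<close>

definition triad_equiv :: "'a::euclidean_space triad \<Rightarrow> 'b::euclidean_space triad \<Rightarrow> bool"
    (infix "\<sim>\<^sub>t" 50) where
  "triad_equiv = (\<lambda>(g, \<theta>\<^sub>1, \<theta>\<^sub>2) (g', \<theta>\<^sub>1', \<theta>\<^sub>2').
     compact_symmetric_triad (g, \<theta>\<^sub>1, \<theta>\<^sub>2) \<and> compact_symmetric_triad (g', \<theta>\<^sub>1', \<theta>\<^sub>2') \<and>
     (\<exists>\<phi> \<tau>. lie_iso g g' \<phi> \<and> \<tau> \<in> Int_group g' \<and>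
        (let \<phi>' = inv_into (carrier g) \<phi>; \<tau>' = inv_into (carrier g') \<tau> in
          \<forall>y\<in>carrier g'. \<theta>\<^sub>1' y = \<phi> (\<theta>\<^sub>1 (\<phi>' y)) \<and> \<theta>\<^sub>2' y = \<tau> (\<phi> (\<theta>\<^sub>2 (\<phi>' (\<tau>' y)))))))"


section \<open>The classical compact Lie algebras\<close>

type_synonym ('a, 'n) sqmat = "(('a, 'n) vec, 'n) vec"

definition commutator :: "'a::ring_1^'n^'n \<Rightarrow> 'a^'n^'n \<Rightarrow> 'a^'n^'n" where
  "commutator A B = A ** B - B ** A"

text \<open>The zero-based position of an index; on the numeral type \<open>n\<close> it takes the values
  \<open>0, \<dots>, n - 1\<close>.\<close>

definition index_pos :: "'n::{finite,linorder} \<Rightarrow> nat" where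
  "index_pos i = card {j. j < i}"

text \<open>\<open>J_mat n\<close> is meant for matrices of size \<open>2 n\<close>: in blocks, \<open>((0, - I), (I, 0))\<close>.\<close>

definition J_mat :: "nat \<Rightarrow> ('a::comm_ring_1, 'n::{finite,linorder}) sqmat" where
  "J_mat n = (\<chi> i j. if index_pos j = index_pos i + n then - 1 else if index_pos i = index_pos j + n then 1 else 0)"

text \<open>\<open>diag_sign a b = diag (I\<^sub>a, - I\<^sub>b)\<close>, for matrices of size \<open>a + b\<close>.\<close>

definition diag_sign :: "nat \<Rightarrow> nat \<Rightarrow> ('a::comm_ring_1, 'n::{finite,linorder}) sqmat" where
  "diag_sign a b = (\<chi> i j. if i \<noteq> j then 0 else if index_pos i < a then 1 else if index_pos i < a + b then - 1 else 0)"

definition conj_by :: "'a::comm_ring_1^'n^'n \<Rightarrow> 'a^'n^'n \<Rightarrow> 'a^'n^'n" where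
  "conj_by M Z = M ** Z ** matrix_inv M"

definition so_alg :: "'n::finite itself \<Rightarrow> (real^'n^'n) lie_alg" where
  "so_alg _ = \<lparr>carrier = {A. transpose A = - A}, bracket = commutator\<rparr>"

definition su_alg :: "'n::finite itself \<Rightarrow> (complex^'n^'n) lie_alg" where
  "su_alg _ = \<lparr>carrier = {A. transpose (map_matrix cnj A) = - A \<and> trace A = 0}, bracket = commutator\<rparr>"

text \<open>\<open>A \<mapsto> J\<^sub>n (cnj A) J\<^sub>n\<^sup>-\<^sup>1\<close> on complex matrices of size \<open>2 n\<close>.\<close>

definition J_conjugation ::
  "nat \<Rightarrow> (complex, 'n::{finite,linorder}) sqmat \<Rightarrow> (complex, 'n) sqmat" where
  "J_conjugation n Z = conj_by (J_mat n) (map_matrix cnj Z)"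

text \<open>The quaternionic algebra \<open>sp(n)\<close> is realised in \<open>su(2 n)\<close>: the quaternionic matrix \<open>A + B j\<close>,
  with \<open>A\<close> and \<open>B\<close> complex, is represented by \<open>((A, B), (- cnj B, cnj A))\<close>, and the complex matrices
  of this form are the fixed points of \<open>J_conjugation n\<close>.  For \<open>n = CARD('m)\<close> the index type
  \<open>'m bit0\<close> has \<open>2 n\<close> elements; for instance \<open>2 bit0\<close> is the type \<open>4\<close>.\<close>

definition sp_alg :: "'m::finite itself \<Rightarrow> (complex^'m bit0^'m bit0) lie_alg" where
  "sp_alg _ = \<lparr>carrier = {A \<in> carrier (su_alg TYPE('m bit0)). J_conjugation CARD('m) A = A},
               bracket = commutator\<rparr>"


section \<open>The standard involutions\<close>

text \<open>Each involution is named after the ambient algebra and the subalgebra that it fixes.\<close>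

definition so_fix_so_so :: "nat \<Rightarrow> nat \<Rightarrow> (real, 'n::{finite,linorder}) sqmat \<Rightarrow> (real, 'n) sqmat" where
  "so_fix_so_so a b = conj_by (diag_sign a b)"

definition so_fix_u :: "nat \<Rightarrow> (real, 'n::{finite,linorder}) sqmat \<Rightarrow> (real, 'n) sqmat" where
  "so_fix_u n = conj_by (J_mat n)"

definition su_fix_so :: "complex^'n^'n \<Rightarrow> complex^'n^'n" where
  "su_fix_so = map_matrix cnj"

definition su_fix_sp :: "nat \<Rightarrow> (complex, 'n::{finite,linorder}) sqmat \<Rightarrow> (complex, 'n) sqmat" where
  "su_fix_sp n = J_conjugation n"

definition su_fix_s_u_u :: "nat \<Rightarrow> nat \<Rightarrow> (complex, 'n::{finite,linorder}) sqmat \<Rightarrow> (complex, 'n) sqmat" where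
  "su_fix_s_u_u a b = conj_by (diag_sign a b)"

text \<open>The quaternionic matrix \<open>diag (I\<^sub>a, - I\<^sub>b)\<close> is represented by the complex matrix
  \<open>diag (I\<^sub>a, - I\<^sub>b, I\<^sub>a, - I\<^sub>b)\<close>.\<close>

definition sp_fix_sp_sp :: "nat \<Rightarrow> nat \<Rightarrow> (complex, 'n::{finite,linorder}) sqmat \<Rightarrow> (complex, 'n) sqmat" where
  "sp_fix_sp_sp a b = conj_by (\<chi> i j. if i \<noteq> j then 0 else if index_pos i mod (a + b) < a then 1 else - 1)"

text \<open>\<open>u(n)\<close> in \<open>sp(n)\<close> consists of the quaternionic matrices with complex entries (\<open>B = 0\<close>), which is
  the fixed point set of conjugation by the quaternionic scalar matrix \<open>i I\<^sub>n\<close>.  The latter is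
  represented by \<open>i diag (I\<^sub>n, - I\<^sub>n)\<close>, and the complex scalar \<open>i\<close> drops out of the conjugation.\<close>

definition sp_fix_u :: "nat \<Rightarrow> (complex, 'n::{finite,linorder}) sqmat \<Rightarrow> (complex, 'n) sqmat" where
  "sp_fix_u n = conj_by (diag_sign n n)"

end

theory Submission
  imports Defs
begin

text \<open>All eight relations come from spin representations.  Let \<open>s\<^sub>i\<close> and \<open>t\<^sub>i\<close>, for \<open>i = 1, \<dots>, n\<close>, be
  square matrices with \<open>t\<^sub>i s\<^sub>j + t\<^sub>j s\<^sub>i = 2 \<delta>\<^sub>i\<^sub>j = s\<^sub>i t\<^sub>j + s\<^sub>j t\<^sub>i\<close>.  Then
  \<open>A \<mapsto> 1/4 \<Sum> a\<^sub>i\<^sub>j t\<^sub>i s\<^sub>j\<close> is a homomorphism of Lie algebras on \<open>\<ss>\<oo>(n)\<close>, and it is injective for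
  \<open>n \<noteq> 4\<close> (\<open>spin_map_hom\<close>, \<open>spin_map_kernel\<close>).  The skew \<open>4 \<times> 4\<close> matrices contain two commuting
  copies \<open>I\<^sub>a\<close> and \<open>K\<^sub>a\<close> of the quaternion units.  The six matrices \<open>I\<^sub>a\<close>, \<open>- \<i> K\<^sub>a\<close> give an isomorphism of
  \<open>\<ss>\<oo>(6)\<close> with \<open>\<ss>\<uu>(4)\<close>; the five of them other than \<open>I\<^sub>1\<close> give an isomorphism of \<open>\<ss>\<oo>(5)\<close> with
  \<open>\<ss>\<pp>(2)\<close>; eight real \<open>8 \<times> 8\<close> matrices built from the same units give an outer automorphism of
  \<open>\<ss>\<oo>(8)\<close>, which is triality.

  An automorphism of the matrix algebra that permutes the \<open>s\<^sub>i\<close> and the \<open>t\<^sub>i\<close> up to sign corresponds to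
  conjugation by a signed permutation matrix on \<open>\<ss>\<oo>(n)\<close> (\<open>spin_map_equivariant\<close>).  This identifies
  every standard involution: for example, complex conjugation fixes \<open>I\<^sub>a\<close>, negates \<open>\<i> K\<^sub>a\<close>, and so
  becomes conjugation by \<open>diag (I\<^sub>3, - I\<^sub>3)\<close>.  The resulting pairs of involutions are not always the
  standard ones.  In five of the eight relations the products \<open>\<theta>\<^sub>1 \<theta>\<^sub>2\<close> on the two sides are not
  even conjugate, so that the inner automorphism \<open>\<tau>\<close> is indispensable.

  For \<open>\<tau>\<close> it suffices to use elements \<open>X\<close> of the Lie algebra with \<open>X\<^sup>2 = - 1\<close>: then
  \<open>exp (\<pi>/2 ad X)\<close> is conjugation by \<open>X\<close> (\<open>half_turn_inner\<close>).  In \<open>\<ss>\<oo>(6)\<close> and \<open>\<ss>\<oo>(8)\<close> the matrix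
  \<open>X\<close> is a signed permutation that moves one diagonal sign pattern to another one; in \<open>\<ss>\<pp>(2)\<close> it is
  the normalised sum of two anticommuting square roots of \<open>- 1\<close>, which it exchanges.

  The Killing forms are negative definite because the Frobenius inner product is invariant and
  the centres are trivial (\<open>compact_semisimple_commutator\<close>).  The isomorphisms carry the triviality
  of the centre, and the involutions, from \<open>\<ss>\<oo>(n)\<close> to the unitary and symplectic algebras.

  All matrices in question except the one for \<open>\<ss>\<pp>(2)\<close> have one nonzero entry in each row.  They
  are stored as lists of columns and values, on which the Clifford relations and the
  equivariance become finite computations.\<close>

section \<open>Matrix multiplication as a bilinear operation\<close>

lemma bounded_bilinear_matmul:
  "bounded_bilinear ((**) :: ('k::{real_algebra_1,euclidean_space})^'m^'l \<Rightarrow> 'k^'n^'m \<Rightarrow> 'k^'n^'l)"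
proof -
  have "bilinear ((**) :: 'k^'m^'l \<Rightarrow> 'k^'n^'m \<Rightarrow> 'k^'n^'l)"
    unfolding bilinear_def
    by (auto intro!: linearI simp: matrix_add_ldistrib matrix_scalar_ac scalar_matrix_assoc
        matrix_matrix_mult_def vec_eq_iff sum.distrib distrib_right distrib_left scaleR_sum_right)
  then show ?thesis
    by (simp add: bilinear_conv_bounded_bilinear)
qed

lemmas matmul_add_left = bounded_bilinear.add_left[OF bounded_bilinear_matmul]
  and matmul_add_right = bounded_bilinear.add_right[OF bounded_bilinear_matmul]
  and matmul_sum_left = bounded_bilinear.sum_left[OF bounded_bilinear_matmul]
  and matmul_sum_right = bounded_bilinear.sum_right[OF bounded_bilinear_matmul]
  and matmul_scaleR_left = bounded_bilinear.scaleR_left[OF bounded_bilinear_matmul]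
  and matmul_scaleR_right = bounded_bilinear.scaleR_right[OF bounded_bilinear_matmul]
  and matmul_minus_left = bounded_bilinear.minus_left[OF bounded_bilinear_matmul]
  and matmul_minus_right = bounded_bilinear.minus_right[OF bounded_bilinear_matmul]
  and matmul_diff_left = bounded_bilinear.diff_left[OF bounded_bilinear_matmul]
  and matmul_diff_right = bounded_bilinear.diff_right[OF bounded_bilinear_matmul]
  and matmul_zero_left = bounded_bilinear.zero_left[OF bounded_bilinear_matmul]
  and matmul_zero_right = bounded_bilinear.zero_right[OF bounded_bilinear_matmul]

lemmas matmul_bilinear = matmul_add_left matmul_add_right matmul_scaleR_left
  matmul_scaleR_right matmul_minus_left matmul_minus_right matmul_diff_left matmul_diff_right
  matmul_zero_left matmul_zero_right

lemma linear_commutator: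
  "linear (commutator (X :: ('k::{real_algebra_1,euclidean_space})^'n^'n))"
  by (rule linearI) (simp_all add: commutator_def matmul_bilinear algebra_simps)

lemma commutator_transpose:
  "transpose (commutator A B) = commutator (transpose B) (transpose (A :: 'k::comm_ring_1^'n^'n))"
proof -
  have [simp]: "transpose (x - y) = transpose x - transpose y" for x y :: "'k^'n^'n"
    by (simp add: transpose_def vec_eq_iff)
  show ?thesis
    by (simp add: commutator_def matrix_transpose_mul)
qed

lemma lie_algebra_commutator:
  fixes V :: "(('k::{real_algebra_1,euclidean_space})^'n^'n) set"
  assumes "subspace V" and "\<And>x y. x \<in> V \<Longrightarrow> y \<in> V \<Longrightarrow> commutator x y \<in> V"
  shows "lie_algebra \<lparr>carrier = V, bracket = commutator\<rparr>"
proof -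
  have *: "commutator (a *\<^sub>R x + b *\<^sub>R y) z = a *\<^sub>R commutator x z + b *\<^sub>R commutator y z"
    "commutator z (a *\<^sub>R x + b *\<^sub>R y) = a *\<^sub>R commutator z x + b *\<^sub>R commutator z y"
    "commutator x x = 0"
    "commutator x (commutator y z) + commutator y (commutator z x) + commutator z (commutator x y) = 0"
    for a b and x y z :: "'k^'n^'n"
    by (simp_all add: commutator_def matmul_bilinear matrix_mul_assoc algebra_simps)
  show ?thesis
    using assms by (auto simp: lie_algebra_def *)
qed

section \<open>Compactness from an invariant inner product\<close>

lemma orthonormal_expansion:
  fixes C :: "'a::euclidean_space set"
  assumes C: "pairwise orthogonal C" "\<And>c. c \<in> C \<Longrightarrow> norm c = 1" "finite C" "v \<in> span C"
  shows "(\<Sum>c\<in>C. (v \<bullet> c) *\<^sub>R c) = v"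
proof -
  have dot: "c \<bullet> d = (if c = d then 1 else 0)" if "c \<in> C" "d \<in> C" for c d
    using that C by (auto simp: pairwise_def orthogonal_def norm_eq_1)
  define w where "w = v - (\<Sum>c\<in>C. (v \<bullet> c) *\<^sub>R c)"
  have wC: "d \<bullet> w = 0" if "d \<in> C" for d
    using that C(3) by (simp add: w_def inner_diff_right inner_sum_right dot inner_commute[of d v] if_distrib
          cong: if_cong)
  have "w \<in> span C"
    unfolding w_def by (intro span_diff C span_sum span_scale span_base)
  then have "w \<bullet> w = 0"
    using orthogonal_to_span[of w C w] wC by (simp add: orthogonal_def inner_commute)
  then show ?thesis by (simp add: w_def)
qed

text \<open>Expand the vectors of the orthonormal basis in the basis that defines the trace, and
  exchange the two summations.\<close>

lemma trace_on_orthonormal: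
  fixes f :: "'a::euclidean_space \<Rightarrow> 'a"
  assumes f: "linear f" and inv: "\<And>x. x \<in> V \<Longrightarrow> f x \<in> V"
    and C: "pairwise orthogonal C" "\<And>c. c \<in> C \<Longrightarrow> norm c = 1" "independent C" "span C = V"
  shows "trace_on V f = (\<Sum>c\<in>C. f c \<bullet> c)"
proof -
  define B where "B = (SOME B. independent B \<and> span B = V)"
  have "\<exists>B. independent B \<and> span B = V"
    using C by blast
  then have B: "independent B" "span B = V"
    unfolding B_def by (metis (mono_tags, lifting) someI_ex)+
  have fin: "finite B" "finite C"
    using B C independent_imp_finite by auto
  have CV: "c \<in> V" if "c \<in> C" for c
    using C(4) span_base that by blast
  have BV: "b \<in> V" if "b \<in> B" for b
    using B(2) span_base that by blast
  have "f c \<bullet> c = (\<Sum>b\<in>B. representation B c b * (f b \<bullet> c))" if "c \<in> C" for c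
  proof -
    have "f c = f (\<Sum>b\<in>B. representation B c b *\<^sub>R b)"
      using sum_representation_eq[of B c B] B fin CV[OF that] by simp
    also have "\<dots> = (\<Sum>b\<in>B. representation B c b *\<^sub>R f b)"
      using f by (simp add: linear_sum linear_cmul)
    finally show ?thesis
      by (simp add: inner_sum_left)
  qed
  then have "(\<Sum>c\<in>C. f c \<bullet> c) = (\<Sum>b\<in>B. \<Sum>c\<in>C. representation B c b * (f b \<bullet> c))"
    by (simp add: sum.swap[of _ B C])
  also have "\<dots> = (\<Sum>b\<in>B. representation B (f b) b)"
  proof (rule sum.cong)
    fix b assume b: "b \<in> B"
    have "f b = (\<Sum>c\<in>C. (f b \<bullet> c) *\<^sub>R c)"
      using orthonormal_expansion[of C "f b"] C fin inv[OF BV[OF b]] by simp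
    then have "representation B (f b) b = representation B (\<Sum>c\<in>C. (f b \<bullet> c) *\<^sub>R c) b"
      by simp
    also have "\<dots> = (\<Sum>c\<in>C. representation B ((f b \<bullet> c) *\<^sub>R c) b)"
      using B CV by (subst representation_sum) (auto simp: span_scale)
    also have "\<dots> = (\<Sum>c\<in>C. (f b \<bullet> c) * representation B c b)"
      using B CV by (intro sum.cong refl) (simp add: representation_scale)
    finally show "(\<Sum>c\<in>C. representation B c b * (f b \<bullet> c)) = representation B (f b) b"
      by (simp add: mult.commute)
  qed simp
  finally show ?thesis
    by (simp add: trace_on_def B_def Let_def)
qed

text \<open>If every \<open>ad x\<close> is skew for an inner product, the Killing form at \<open>(x, x)\<close> is minus the
  squared Hilbert-Schmidt norm of \<open>ad x\<close>, so that only central elements have length zero.\<close>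

lemma compact_semisimple_commutator:
  fixes V :: "(('k::{real_algebra_1,euclidean_space})^'n^'n) set"
  assumes V: "subspace V" and closed: "\<And>x y. x \<in> V \<Longrightarrow> y \<in> V \<Longrightarrow> commutator x y \<in> V"
    and skew: "\<And>x y z. x \<in> V \<Longrightarrow> commutator x y \<bullet> z = - (y \<bullet> commutator x z)"
    and centre: "\<And>x. x \<in> V \<Longrightarrow> (\<And>y. y \<in> V \<Longrightarrow> commutator x y = 0) \<Longrightarrow> x = 0"
  shows "compact_semisimple \<lparr>carrier = V, bracket = commutator\<rparr>"
proof -
  obtain C where "C \<subseteq> V" and C: "pairwise orthogonal C" "\<And>c. c \<in> C \<Longrightarrow> norm c = 1"
    "independent C" "span C = V"
    using orthonormal_basis_subspace[OF V] by metis
  have fin: "finite C"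
    using C independent_imp_finite by auto
  have "trace_on V (commutator x \<circ> commutator x) < 0" if x: "x \<in> V" "x \<noteq> 0" for x
  proof -
    have "trace_on V (commutator x \<circ> commutator x) = (\<Sum>c\<in>C. commutator x (commutator x c) \<bullet> c)"
      using trace_on_orthonormal[of "commutator x \<circ> commutator x" V C] C closed x
        linear_compose[OF linear_commutator linear_commutator, of x x] by simp
    also have "\<dots> = - (\<Sum>c\<in>C. commutator x c \<bullet> commutator x c)"
      using x by (simp add: skew sum_negf)
    also have "\<dots> < 0"
    proof -
      have "\<exists>c\<in>C. commutator x c \<noteq> 0"
      proof (rule ccontr)
        assume "\<not> ?thesis"
        then have "commutator x y = 0" if "y \<in> V" for y
          using linear_eq_0_on_span[OF linear_commutator, of C x y] that C by auto
        then show False using centre x by blast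
      qed
      then have "0 < (\<Sum>c\<in>C. commutator x c \<bullet> commutator x c)"
        using fin by (metis (no_types, lifting) inner_ge_zero inner_gt_zero_iff sum_pos2)
      then show ?thesis by simp
    qed
    finally show ?thesis .
  qed
  then show ?thesis
    using lie_algebra_commutator[OF V closed] by (simp add: compact_semisimple_def killing_form_def)
qed

section \<open>Inner automorphisms from complex structures\<close>

text \<open>Since \<open>a\<^sup>3 = - a\<close> at \<open>y\<close>, the exponential series of \<open>t a\<close> sums to
  \<open>y + sin t \<cdot> a y + (1 - cos t) \<cdot> a\<^sup>2 y\<close>; here \<open>t = \<pi>\<close>.\<close>

lemma exp_half_turn:
  fixes a :: "'v::real_normed_vector \<Rightarrow> 'v"
  assumes a3: "a (a (a y)) = - a y" and a: "linear a"
  shows "(\<lambda>n. (1 / fact n) *\<^sub>R ((\<lambda>z. pi *\<^sub>R a z) ^^ n) y) sums (y + 2 *\<^sub>R a (a y))"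
proof -
  have pow: "((\<lambda>z. pi *\<^sub>R a z) ^^ n) y = pi ^ n *\<^sub>R
      (if n = 0 then y else if even n then - ((- 1) ^ (n div 2) *\<^sub>R a (a y))
       else (- 1) ^ ((n - 1) div 2) *\<^sub>R a y)" for n
  proof (induction n)
    case (Suc n)
    then show ?case
      using a a3
      by (auto simp: linear_scale linear_neg elim!: evenE oddE)
  qed simp
  have summand: "(1 / fact n) *\<^sub>R ((\<lambda>z. pi *\<^sub>R a z) ^^ n) y =
      (if n = 0 then y + a (a y) else 0)
      + ((sin_coeff n *\<^sub>R pi ^ n) *\<^sub>R a y - (cos_coeff n *\<^sub>R pi ^ n) *\<^sub>R a (a y))" for n
    unfolding pow by (auto simp: sin_coeff_def cos_coeff_def elim!: evenE oddE)
  have "(\<lambda>n. if n = 0 then y + a (a y) else 0) sums (y + a (a y))"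
    using sums_If_finite_set[of "{0::nat}" "\<lambda>_. y + a (a y)"] by simp
  moreover have "(\<lambda>n. (sin_coeff n *\<^sub>R pi ^ n) *\<^sub>R a y) sums (sin pi *\<^sub>R a y)"
    by (intro sums_scaleR_left sin_converges)
  moreover have "(\<lambda>n. (cos_coeff n *\<^sub>R pi ^ n) *\<^sub>R a (a y)) sums (cos pi *\<^sub>R a (a y))"
    by (intro sums_scaleR_left cos_converges)
  ultimately have "(\<lambda>n. (1 / fact n) *\<^sub>R ((\<lambda>z. pi *\<^sub>R a z) ^^ n) y) sums
      ((y + a (a y)) + (sin pi *\<^sub>R a y - cos pi *\<^sub>R a (a y)))"
    unfolding summand by (intro sums_add sums_diff)
  then show ?thesis
    by (simp add: scaleR_2 algebra_simps)
qed

lemma commutator_twice: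
  fixes X :: "('k::{real_algebra_1,euclidean_space})^'n^'n"
  assumes X: "X ** X = - mat 1"
  shows "commutator X (commutator X Z) = - (2 *\<^sub>R (Z + X ** Z ** X))"
proof -
  have "X ** (X ** W) = - W" for W :: "'k^'n^'n"
    by (simp add: matrix_mul_assoc X matmul_bilinear)
  then show ?thesis
    by (simp add: commutator_def matmul_bilinear matrix_mul_assoc[symmetric] X scaleR_2)
qed

text \<open>For \<open>X\<^sup>2 = - 1\<close> the map \<open>ad (X / 2)\<close> has the eigenvalues \<open>0\<close> and \<open>\<plusminus> \<i>\<close>, so that
  \<open>exp (\<pi> ad (X / 2))\<close> is conjugation by \<open>exp (\<pi> X / 2) = X\<close>.\<close>

lemma half_turn_inner:
  fixes X :: "('k::{real_algebra_1,euclidean_space})^'n^'n"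
  assumes X: "X ** X = - mat 1" "X \<in> carrier g" and g: "subspace (carrier g)" "bracket g = commutator"
  shows "(\<lambda>Y. - (X ** Y ** X)) \<in> Int_group g"
proof -
  have XX: "X ** (X ** Z) = - Z" "Z ** X ** X = - Z" for Z :: "'k^'n^'n"
    using X(1) by (simp_all add: matrix_mul_assoc matmul_bilinear flip: matrix_mul_assoc[of Z X X])
  have "exp_ad g ((pi / 2) *\<^sub>R X) Y = - (X ** Y ** X)" for Y
  proof -
    define a where "a Z = (1 / 2) *\<^sub>R commutator X Z" for Z
    have lin: "linear a"
      unfolding a_def using linear_commutator[of X] by (simp add: linear_compose_scale_right)
    have a2: "a (a Z) = - ((1 / 2) *\<^sub>R (Z + X ** Z ** X))" for Z
      by (simp add: a_def commutator_twice[OF X(1)] linear_scale[OF linear_commutator] scaleR_right_diff_distrib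
          scaleR_add_right)
    have "commutator X (Z + X ** Z ** X) = 2 *\<^sub>R commutator X Z" for Z
      by (simp add: commutator_def matmul_bilinear matrix_mul_assoc[symmetric] XX X(1) scaleR_2)
    then have a3: "a (a (a Y)) = - a Y"
      by (simp add: a2 linear_neg[OF lin] linear_scale[OF lin]) (simp add: a_def)
    have "bracket g ((pi / 2) *\<^sub>R X) = (\<lambda>Z. pi *\<^sub>R a Z)"
      by (simp add: fun_eq_iff g(2) a_def commutator_def matmul_bilinear scaleR_right_diff_distrib)
    then have "exp_ad g ((pi / 2) *\<^sub>R X) Y = Y + 2 *\<^sub>R a (a Y)"
      using exp_half_turn[OF a3 lin] by (simp add: exp_ad_def sums_iff)
    then show ?thesis by (simp add: a2)
  qed
  then have "exp_ad g ((pi / 2) *\<^sub>R X) \<circ> id = (\<lambda>Y. - (X ** Y ** X))"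
    by auto
  moreover have "(pi / 2) *\<^sub>R X \<in> carrier g"
    using g X subspace_scale by blast
  ultimately show ?thesis
    using Int_group.exp_ad[OF _ Int_group.id] by metis
qed

section \<open>Transport along an isomorphism\<close>

lemma lie_iso_inv:
  assumes f: "lie_iso g h f" and g: "lie_algebra g"
  shows "lie_iso h g (inv_into (carrier g) f)"
proof -
  define k where "k = inv_into (carrier g) f"
  have bij: "bij_betw f (carrier g) (carrier h)"
    using f by (simp add: lie_iso_def)
  have k: "k y \<in> carrier g" "f (k y) = y" if "y \<in> carrier h" for y
    using that bij unfolding k_def
    by (simp_all add: bij_betw_inv_into_right inv_into_into bij_betw_imp_surj_on)
  have kf: "k (f x) = x" if "x \<in> carrier g" for x
    using that bij by (simp add: k_def bij_betw_inv_into_left)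
  have sub: "subspace (carrier g)" "\<And>x y. x \<in> carrier g \<Longrightarrow> y \<in> carrier g \<Longrightarrow> bracket g x y \<in> carrier g"
    using g by (auto simp: lie_algebra_def)
  have "k (x + y) = k x + k y" if "x \<in> carrier h" "y \<in> carrier h" for x y
  proof -
    have "f (k x + k y) = x + y"
      using f that k by (simp add: lie_iso_def)
    then show ?thesis
      using kf[of "k x + k y"] k that subspace_add[OF sub(1)] by simp
  qed
  moreover have "k (a *\<^sub>R x) = a *\<^sub>R k x" if "x \<in> carrier h" for a x
  proof -
    have "f (a *\<^sub>R k x) = a *\<^sub>R x"
      using f that k by (simp add: lie_iso_def)
    then show ?thesis
      using kf[of "a *\<^sub>R k x"] k that subspace_scale[OF sub(1)] by simp
  qed
  moreover have "k (bracket h x y) = bracket g (k x) (k y)" if "x \<in> carrier h" "y \<in> carrier h" for x y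
  proof -
    have "f (bracket g (k x) (k y)) = bracket h x y"
      using f that k by (simp add: lie_iso_def)
    then show ?thesis
      using kf[of "bracket g (k x) (k y)"] k that sub(2) by simp
  qed
  ultimately show ?thesis
    unfolding lie_iso_def k_def[symmetric] using bij_betw_inv_into[OF bij] k_def by simp
qed

lemma lie_iso_comp:
  assumes "lie_iso g h f" "lie_iso h k e"
  shows "lie_iso g k (e \<circ> f)"
proof -
  have "f x \<in> carrier h" if "x \<in> carrier g" for x
    using that assms(1) by (auto simp: lie_iso_def bij_betw_def)
  then show ?thesis
    using assms bij_betw_trans[of f "carrier g" "carrier h" e "carrier k"]
    by (simp add: lie_iso_def)
qed

lemma lie_iso_cong:
  assumes "lie_iso g h f" "lie_algebra g" "\<And>x. x \<in> carrier g \<Longrightarrow> f' x = f x"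
  shows "lie_iso g h f'"
  using assms unfolding lie_iso_def lie_algebra_def
  by (simp add: subspace_add subspace_scale cong: bij_betw_cong)

lemma lie_iso_in_carrier: "lie_iso g h f \<Longrightarrow> x \<in> carrier g \<Longrightarrow> f x \<in> carrier h"
  by (auto simp: lie_iso_def bij_betw_def)

lemma lie_involution_transport:
  assumes \<psi>: "lie_iso h g \<psi>" and h: "lie_algebra h" and g: "lie_algebra g"
    and \<theta>': "lie_involution h \<theta>'" and eq: "\<And>y. y \<in> carrier h \<Longrightarrow> \<theta> (\<psi> y) = \<psi> (\<theta>' y)"
  shows "lie_involution g \<theta>"
proof -
  define k where "k = inv_into (carrier h) \<psi>"
  have bij: "bij_betw \<psi> (carrier h) (carrier g)"
    using \<psi> by (simp add: lie_iso_def)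
  have k: "k x \<in> carrier h" "\<psi> (k x) = x" if "x \<in> carrier g" for x
    using that bij unfolding k_def
    by (simp_all add: bij_betw_inv_into_right inv_into_into bij_betw_imp_surj_on)
  have \<theta>: "\<theta> x = ((\<psi> \<circ> \<theta>') \<circ> k) x" if "x \<in> carrier g" for x
    using eq[of "k x"] k that by simp
  have aut: "lie_iso h h \<theta>'"
    using \<theta>' by (simp add: lie_involution_def)
  have "lie_iso g g \<theta>"
    using lie_iso_cong[OF lie_iso_comp[OF lie_iso_inv[OF \<psi> h] lie_iso_comp[OF aut \<psi>]] g] \<theta>
    unfolding k_def by simp
  moreover have "\<theta> (\<theta> x) = x" if "x \<in> carrier g" for x
    using \<theta>' k that lie_iso_in_carrier[OF aut] eq by (simp add: \<theta>[OF that] lie_involution_def)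
  moreover obtain y where y: "y \<in> carrier h" "\<theta>' y \<noteq> y"
    using \<theta>' by (auto simp: lie_involution_def)
  then have "\<theta> (\<psi> y) \<noteq> \<psi> y"
    using bij lie_iso_in_carrier[OF aut] by (auto simp: eq bij_betw_def inj_on_def)
  ultimately show ?thesis
    using y lie_iso_in_carrier[OF \<psi>] by (auto simp: lie_involution_def)
qed

lemma id_inner:
  assumes "lie_algebra g"
  shows "id \<in> Int_group g" "lie_aut g id"
  using assms by (simp_all add: Int_group.id lie_iso_def)

text \<open>Substituting \<open>y = \<phi> x\<close> and \<open>y = \<tau> (\<phi> x)\<close> removes the inverse maps from the definition.\<close>

lemma triad_equivI:
  assumes "compact_symmetric_triad (g, \<theta>\<^sub>1, \<theta>\<^sub>2)" "compact_symmetric_triad (g', \<theta>\<^sub>1', \<theta>\<^sub>2')"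
    and \<phi>: "lie_iso g g' \<phi>" and \<tau>: "\<tau> \<in> Int_group g'" "bij_betw \<tau> (carrier g') (carrier g')"
    and 1: "\<And>x. x \<in> carrier g \<Longrightarrow> \<theta>\<^sub>1' (\<phi> x) = \<phi> (\<theta>\<^sub>1 x)"
    and 2: "\<And>x. x \<in> carrier g \<Longrightarrow> \<theta>\<^sub>2' (\<tau> (\<phi> x)) = \<tau> (\<phi> (\<theta>\<^sub>2 x))"
  shows "(g, \<theta>\<^sub>1, \<theta>\<^sub>2) \<sim>\<^sub>t (g', \<theta>\<^sub>1', \<theta>\<^sub>2')"
proof -
  have bij: "bij_betw \<phi> (carrier g) (carrier g')"
    using \<phi> by (simp add: lie_iso_def)
  have inv: "inv_into (carrier g) \<phi> y \<in> carrier g" "\<phi> (inv_into (carrier g) \<phi> y) = y"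
    "inv_into (carrier g') \<tau> y \<in> carrier g'" "\<tau> (inv_into (carrier g') \<tau> y) = y"
    if "y \<in> carrier g'" for y
    using that bij \<tau>(2)
    by (simp_all add: bij_betw_inv_into_right inv_into_into bij_betw_imp_surj_on)
  have "\<theta>\<^sub>1' y = \<phi> (\<theta>\<^sub>1 (inv_into (carrier g) \<phi> y))" if "y \<in> carrier g'" for y
    using that inv 1 by metis
  moreover have "\<theta>\<^sub>2' y = \<tau> (\<phi> (\<theta>\<^sub>2 (inv_into (carrier g) \<phi> (inv_into (carrier g') \<tau> y))))"
    if "y \<in> carrier g'" for y
    using that inv 2 by metis
  ultimately show ?thesis
    using assms unfolding triad_equiv_def Let_def by blast
qed

text \<open>All involutions are pulled back along an isomorphism \<open>\<psi>\<close> from the second algebra; the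
  pullback \<open>\<rho>\<close> of \<open>\<theta>\<^sub>2\<close> only has to agree with \<open>\<theta>\<^sub>2'\<close> up to the inner automorphism \<open>\<tau>\<close>.\<close>

lemma triad_equiv_pullback:
  assumes \<psi>: "lie_iso g' g \<psi>" and g: "compact_semisimple g" and g': "compact_semisimple g'"
    and inv: "lie_involution g' \<theta>\<^sub>1'" "lie_involution g' \<theta>\<^sub>2'" "lie_involution g' \<rho>"
    and \<tau>: "\<tau> \<in> Int_group g'" "lie_aut g' \<tau>"
    and 1: "\<And>y. y \<in> carrier g' \<Longrightarrow> \<theta>\<^sub>1 (\<psi> y) = \<psi> (\<theta>\<^sub>1' y)"
    and 2: "\<And>y. y \<in> carrier g' \<Longrightarrow> \<theta>\<^sub>2 (\<psi> y) = \<psi> (\<rho> y)"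
    and 3: "\<And>y. y \<in> carrier g' \<Longrightarrow> \<theta>\<^sub>2' (\<tau> y) = \<tau> (\<rho> y)"
  shows "(g, \<theta>\<^sub>1, \<theta>\<^sub>2) \<sim>\<^sub>t (g', \<theta>\<^sub>1', \<theta>\<^sub>2')"
proof (rule triad_equivI)
  have alg: "lie_algebra g" "lie_algebra g'"
    using g g' by (simp_all add: compact_semisimple_def)
  have "lie_involution g \<theta>\<^sub>1" "lie_involution g \<theta>\<^sub>2"
    using lie_involution_transport[OF \<psi> alg(2,1)] inv 1 2 by blast+
  then show "compact_symmetric_triad (g, \<theta>\<^sub>1, \<theta>\<^sub>2)" "compact_symmetric_triad (g', \<theta>\<^sub>1', \<theta>\<^sub>2')"
    using g g' inv by (simp_all add: compact_symmetric_triad_def)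
  define \<phi> where "\<phi> = inv_into (carrier g') \<psi>"
  show "lie_iso g g' \<phi>"
    unfolding \<phi>_def using \<psi> alg by (intro lie_iso_inv)
  have bij: "bij_betw \<psi> (carrier g') (carrier g)"
    using \<psi> by (simp add: lie_iso_def)
  have \<phi>\<psi>: "\<phi> (\<psi> y) = y" if "y \<in> carrier g'" for y
    using that bij by (simp add: \<phi>_def bij_betw_inv_into_left)
  have \<rho>: "\<rho> y \<in> carrier g'" "\<theta>\<^sub>1' y \<in> carrier g'" if "y \<in> carrier g'" for y
    using inv that lie_iso_in_carrier by (auto simp: lie_involution_def)
  fix x assume "x \<in> carrier g"
  then obtain y where y: "y \<in> carrier g'" "x = \<psi> y"
    using bij by (auto simp: bij_betw_def)
  then show "\<theta>\<^sub>1' (\<phi> x) = \<phi> (\<theta>\<^sub>1 x)" "\<theta>\<^sub>2' (\<tau> (\<phi> x)) = \<tau> (\<phi> (\<theta>\<^sub>2 x))"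
    using \<rho> by (simp_all add: 1 2 3 \<phi>\<psi>)
qed (use \<tau> in \<open>simp_all add: lie_iso_def\<close>)

text \<open>An inner automorphism \<open>\<tau>\<close> that is needed for the first involution can be moved to the second
  one by composing the isomorphism with \<open>\<tau>\<close>; the inverse of \<open>\<tau>\<close> is then needed, so
  \<open>\<tau>\<close> is taken to be an involution.\<close>

lemma triad_equiv_pullback':
  assumes \<psi>: "lie_iso g' g \<psi>" and g: "compact_semisimple g" and g': "compact_semisimple g'"
    and inv: "lie_involution g' \<theta>\<^sub>1'" "lie_involution g' \<theta>\<^sub>2'" "lie_involution g' \<rho>"
    and \<tau>: "\<tau> \<in> Int_group g'" "lie_aut g' \<tau>" "\<And>y. y \<in> carrier g' \<Longrightarrow> \<tau> (\<tau> y) = y"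
    and 1: "\<And>y. y \<in> carrier g' \<Longrightarrow> \<theta>\<^sub>1 (\<psi> y) = \<psi> (\<rho> y)"
    and 2: "\<And>y. y \<in> carrier g' \<Longrightarrow> \<theta>\<^sub>2 (\<psi> y) = \<psi> (\<theta>\<^sub>2' y)"
    and 3: "\<And>y. y \<in> carrier g' \<Longrightarrow> \<theta>\<^sub>1' (\<tau> y) = \<tau> (\<rho> y)"
  shows "(g, \<theta>\<^sub>1, \<theta>\<^sub>2) \<sim>\<^sub>t (g', \<theta>\<^sub>1', \<theta>\<^sub>2')"
proof (rule triad_equiv_pullback[where \<psi> = "\<psi> \<circ> \<tau>" and \<tau> = \<tau> and \<rho> = "\<tau> \<circ> \<theta>\<^sub>2' \<circ> \<tau>"])
  have alg: "lie_algebra g'"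
    using g' by (simp add: compact_semisimple_def)
  have c: "\<tau> y \<in> carrier g'" "\<theta>\<^sub>2' y \<in> carrier g'" "\<theta>\<^sub>1' y \<in> carrier g'" "\<rho> y \<in> carrier g'"
    if "y \<in> carrier g'" for y
    using inv \<tau> that lie_iso_in_carrier by (auto simp: lie_involution_def)
  show "lie_iso g' g (\<psi> \<circ> \<tau>)"
    using lie_iso_comp[OF \<tau>(2) \<psi>] .
  show "lie_involution g' (\<tau> \<circ> \<theta>\<^sub>2' \<circ> \<tau>)"
    using lie_involution_transport[OF \<tau>(2) alg alg inv(2)] c \<tau>(3) by simp
  fix y assume y: "y \<in> carrier g'"
  have "\<rho> (\<tau> y) = \<tau> (\<theta>\<^sub>1' y)"
    using 3[of "\<tau> y"] \<tau>(3) c y by metis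
  then show "\<theta>\<^sub>1 ((\<psi> \<circ> \<tau>) y) = (\<psi> \<circ> \<tau>) (\<theta>\<^sub>1' y)"
    using 1 c y by simp
  show "\<theta>\<^sub>2 ((\<psi> \<circ> \<tau>) y) = (\<psi> \<circ> \<tau>) ((\<tau> \<circ> \<theta>\<^sub>2' \<circ> \<tau>) y)"
    "\<theta>\<^sub>2' (\<tau> y) = \<tau> ((\<tau> \<circ> \<theta>\<^sub>2' \<circ> \<tau>) y)"
    using 2 c y \<tau>(3) by simp_all
qed (use assms in auto)

section \<open>Conjugation by square roots of plus or minus one\<close>

lemma conj_by_sqrt:
  fixes P :: "('k::{comm_ring_1,real_algebra_1,euclidean_space})^'n^'n"
  assumes P: "P ** P = \<epsilon> *\<^sub>R mat 1" and \<epsilon>: "\<epsilon> * \<epsilon> = 1"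
  shows "conj_by P = (\<lambda>Z. \<epsilon> *\<^sub>R (P ** Z ** P))"
proof -
  have inv: "P ** (\<epsilon> *\<^sub>R P) = mat 1 \<and> (\<epsilon> *\<^sub>R P) ** P = mat 1"
    using assms by (simp add: matmul_bilinear)
  then have "P ** matrix_inv P = mat 1 \<and> matrix_inv P ** P = mat 1"
    unfolding matrix_inv_def by (rule someI)
  then have "matrix_inv P = \<epsilon> *\<^sub>R P"
    using inv by (metis matrix_mul_assoc matrix_mul_lid matrix_mul_rid)
  then show ?thesis
    by (simp add: conj_by_def fun_eq_iff matmul_bilinear)
qed

lemma conj_by_sqrt_hom:
  fixes P :: "('k::{comm_ring_1,real_algebra_1,euclidean_space})^'n^'n"
  assumes P: "P ** P = \<epsilon> *\<^sub>R mat 1" and \<epsilon>: "\<epsilon> * \<epsilon> = 1"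
  shows "linear (conj_by P)" "conj_by P (conj_by P Y) = Y"
    "conj_by P (Y ** Z) = conj_by P Y ** conj_by P Z"
    "conj_by P (commutator Y Z) = commutator (conj_by P Y) (conj_by P Z)"
proof -
  have PP: "P ** (P ** Z) = \<epsilon> *\<^sub>R Z" for Z :: "'k^'n^'n"
    by (simp add: matrix_mul_assoc P matmul_bilinear)
  have \<epsilon>': "\<epsilon> * (\<epsilon> * r) = r" for r
    using \<epsilon> by (simp flip: mult.assoc)
  show lin: "linear (conj_by P)"
    unfolding conj_by_sqrt[OF assms]
    by (rule linearI) (simp_all add: matmul_bilinear scaleR_add_right mult.commute)
  show "conj_by P (conj_by P Y) = Y"
    by (simp add: conj_by_sqrt[OF assms] matmul_bilinear matrix_mul_assoc[symmetric] PP P \<epsilon> \<epsilon>')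
  show mult: "conj_by P (Y ** Z) = conj_by P Y ** conj_by P Z" for Y Z
    by (simp add: conj_by_sqrt[OF assms] matmul_bilinear matrix_mul_assoc[symmetric] PP P \<epsilon> \<epsilon>')
  show "conj_by P (commutator Y Z) = commutator (conj_by P Y) (conj_by P Z)"
    unfolding commutator_def linear_diff[OF lin] mult ..
qed

lemma conj_by_lie_aut:
  fixes P :: "('k::{comm_ring_1,real_algebra_1,euclidean_space})^'n^'n"
  assumes P: "P ** P = \<epsilon> *\<^sub>R mat 1" and \<epsilon>: "\<epsilon> * \<epsilon> = 1"
    and V: "\<And>Z. Z \<in> V \<Longrightarrow> conj_by P Z \<in> V"
  shows "lie_aut \<lparr>carrier = V, bracket = commutator\<rparr> (conj_by P)"
proof -
  have "bij_betw (conj_by P) V V"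
    by (rule bij_betw_byWitness[where f' = "conj_by P"]) (use V conj_by_sqrt_hom[OF P \<epsilon>] in auto)
  then show ?thesis
    using conj_by_sqrt_hom[OF P \<epsilon>] by (simp add: lie_iso_def linear_add linear_scale)
qed

lemma conj_by_inner:
  fixes X :: "('k::{comm_ring_1,real_algebra_1,euclidean_space})^'n^'n"
  assumes "X ** X = - mat 1" "X \<in> carrier g" "subspace (carrier g)" "bracket g = commutator"
  shows "conj_by X \<in> Int_group g"
  using half_turn_inner[OF assms] conj_by_sqrt[of X "- 1"] assms(1) by simp

text \<open>The two intertwining relations give \<open>P (X Z X) P = X (R Z R) X\<close>, and the signs \<open>\<epsilon>\<close> and \<open>\<delta>\<close> of the
  inverses are the same on both sides.\<close>

lemma conj_by_intertwine:
  fixes P X R :: "('k::{comm_ring_1,real_algebra_1,euclidean_space})^'n^'n"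
  assumes "P ** P = \<epsilon> *\<^sub>R mat 1" "R ** R = \<epsilon> *\<^sub>R mat 1" "\<epsilon> * \<epsilon> = 1" "X ** X = \<delta> *\<^sub>R mat 1" "\<delta> * \<delta> = 1"
    and "P ** X = X ** R" "X ** P = R ** X"
  shows "conj_by P (conj_by X Z) = conj_by X (conj_by R Z)"
proof -
  have "P ** (X ** Z ** X) ** P = (P ** X) ** Z ** (X ** P)"
    by (simp add: matrix_mul_assoc)
  also have "\<dots> = X ** (R ** Z ** R) ** X"
    by (simp add: assms(6,7) matrix_mul_assoc)
  finally show ?thesis
    by (simp add: conj_by_sqrt[OF assms(1,3)] conj_by_sqrt[OF assms(2,3)] conj_by_sqrt[OF assms(4,5)]
        matmul_bilinear mult.commute)
qed

section \<open>The orthogonal Lie algebras\<close>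

lemma transpose_linear:
  "transpose (x + y) = transpose x + transpose y" "transpose (- x) = - transpose x"
  "transpose (x - y) = transpose x - transpose y" "transpose (0 :: 'a^'n^'m) = 0"
  for x y :: "'a::ab_group_add^'n^'m"
  by (simp_all add: transpose_def vec_eq_iff)

lemma transpose_scaleR: "transpose (a *\<^sub>R x) = a *\<^sub>R transpose x"
  for x :: "'a::real_vector^'n^'m"
  by (simp add: transpose_def vec_eq_iff)

lemma so_carrier: "A \<in> carrier (so_alg T) \<longleftrightarrow> transpose A = - A"
  by (simp add: so_alg_def)

lemma so_alg_eq: "so_alg T = \<lparr>carrier = carrier (so_alg T), bracket = commutator\<rparr>"
  by (simp add: so_alg_def)

lemma subspace_so: "subspace {A :: real^'n^'n. transpose A = - A}"
  by (simp add: subspace_def transpose_linear transpose_scaleR)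

lemma so_entry:
  fixes A :: "real^'n^'n"
  assumes "transpose A = - A"
  shows "A $ j $ i = - (A $ i $ j)"
proof -
  have "transpose A $ i $ j = (- A) $ i $ j"
    using assms by simp
  then show ?thesis by (simp add: transpose_def)
qed

definition so_elem :: "'n \<Rightarrow> 'n \<Rightarrow> real^'n^'n" where
  "so_elem p q = (\<chi> i j. (if i = p \<and> j = q then 1 else 0) - (if i = q \<and> j = p then 1 else 0))"

lemma so_elem_in_so: "so_elem p q \<in> carrier (so_alg T)"
  by (simp add: so_carrier so_elem_def transpose_def vec_eq_iff conj_commute)

text \<open>Comparing entries in \<open>P E = E P\<close> for the elementary skew matrices \<open>E\<close>; a third index is needed
  for the off-diagonal entries of \<open>P\<close>.\<close>

lemma so_commutant_scalar:
  fixes P :: "real^'n^'n"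
  assumes n: "3 \<le> CARD('n)" and P: "\<And>A. A \<in> carrier (so_alg TYPE('n)) \<Longrightarrow> P ** A = A ** P"
  shows "\<exists>c. P = c *\<^sub>R mat 1"
proof -
  have left: "(P ** so_elem p q) $ i $ j = (if j = q then P $ i $ p else 0) - (if j = p then P $ i $ q else 0)"
    for p q i j
    by (cases "j = q"; cases "j = p") (simp_all add: matrix_matrix_mult_def so_elem_def
        right_diff_distrib sum_subtractf if_distrib[of "(*) x" for x] cong: if_cong)
  have right: "(so_elem p q ** P) $ i $ j = (if i = p then P $ q $ j else 0) - (if i = q then P $ p $ j else 0)"
    for p q i j
    by (cases "i = q"; cases "i = p") (simp_all add: matrix_matrix_mult_def so_elem_def
        left_diff_distrib sum_subtractf if_distrib[of "\<lambda>x. x * y" for y] cong: if_cong)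
  have eq: "(P ** so_elem p q) $ i $ j = (so_elem p q ** P) $ i $ j" for p q i j
    using P[OF so_elem_in_so] by simp
  have off: "P $ a $ b = 0" if "a \<noteq> b" for a b
  proof -
    have "\<not> UNIV \<subseteq> {a, b}"
      using n card_mono[of "{a, b}" UNIV] card_insert_le_m1[of 2 "{b}" a] by force
    then obtain c where "c \<noteq> a" "c \<noteq> b" by auto
    then show ?thesis
      using eq[of b c a c] that unfolding left right by simp
  qed
  have "P $ a $ a = P $ b $ b" for a b
    using eq[of a b a b] unfolding left right by (cases "a = b") auto
  then obtain c where "\<And>a. P $ a $ a = c" by metis
  then have "P = c *\<^sub>R mat 1"
    using off by (auto simp: vec_eq_iff mat_def)
  then show ?thesis ..
qed

lemma so_centre:
  fixes A :: "real^'n^'n"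
  assumes n: "3 \<le> CARD('n)" and A: "A \<in> carrier (so_alg TYPE('n))"
    and comm: "\<And>B. B \<in> carrier (so_alg TYPE('n)) \<Longrightarrow> commutator A B = 0"
  shows "A = 0"
proof -
  obtain c where c: "A = c *\<^sub>R mat 1"
    using so_commutant_scalar[OF n, of A] comm by (auto simp: commutator_def)
  have "A $ a $ a = 0" for a
    using so_entry[of A a a] A by (simp add: so_carrier)
  then have "c = 0"
    by (simp add: c mat_def)
  then show ?thesis
    by (simp add: c)
qed

lemma inner_matmul_real:
  fixes x y z :: "real^'n^'n"
  shows "(x ** y) \<bullet> z = y \<bullet> (transpose x ** z)" "(x ** y) \<bullet> z = x \<bullet> (z ** transpose y)"
proof -
  have "(x ** y) \<bullet> z = (\<Sum>i\<in>UNIV. \<Sum>j\<in>UNIV. \<Sum>k\<in>UNIV. x$i$k * y$k$j * z$i$j)"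
    by (simp add: inner_vec_def matrix_matrix_mult_def sum_distrib_right)
  moreover have "\<dots> = (\<Sum>k\<in>UNIV. \<Sum>j\<in>UNIV. \<Sum>i\<in>UNIV. x$i$k * y$k$j * z$i$j)"
    by (subst sum.swap, subst (2) sum.swap, subst sum.swap) (rule refl)
  moreover have "\<dots> = y \<bullet> (transpose x ** z)"
    by (simp add: inner_vec_def matrix_matrix_mult_def sum_distrib_left transpose_def mult_ac)
  moreover have "(\<Sum>i\<in>UNIV. \<Sum>j\<in>UNIV. \<Sum>k\<in>UNIV. x$i$k * y$k$j * z$i$j) =
      (\<Sum>i\<in>UNIV. \<Sum>k\<in>UNIV. \<Sum>j\<in>UNIV. x$i$k * y$k$j * z$i$j)"
    by (subst (2) sum.swap) (rule refl)
  moreover have "\<dots> = x \<bullet> (z ** transpose y)"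
    by (simp add: inner_vec_def matrix_matrix_mult_def sum_distrib_left transpose_def mult_ac)
  ultimately show "(x ** y) \<bullet> z = y \<bullet> (transpose x ** z)" "(x ** y) \<bullet> z = x \<bullet> (z ** transpose y)"
    by simp_all
qed

lemma commutator_in_so:
  fixes x y :: "real^'n^'n"
  assumes "transpose x = - x" "transpose y = - y"
  shows "transpose (commutator x y) = - commutator x y"
  using assms by (simp add: commutator_transpose) (simp add: commutator_def matmul_bilinear)

lemma so_compact_semisimple:
  assumes n: "3 \<le> CARD('n)"
  shows "compact_semisimple (so_alg TYPE('n::finite))"
  unfolding so_alg_def
proof (rule compact_semisimple_commutator)
  fix x y z :: "real^'n^'n" assume "x \<in> {A. transpose A = - A}"
  then have x: "transpose x = - x" by simp
  show "commutator x y \<bullet> z = - (y \<bullet> commutator x z)"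
    using inner_matmul_real(1)[of x y z] inner_matmul_real(2)[of y x z] x
    by (simp add: commutator_def inner_diff_left inner_diff_right matmul_bilinear
        inner_matmul_real(1)[of x y z] inner_matmul_real(2)[of y x z])
qed (use so_centre[OF n] commutator_in_so in \<open>auto simp: subspace_so so_alg_def\<close>)

lemma so_lie_algebra: "lie_algebra (so_alg TYPE('n::finite))"
  unfolding so_alg_def using commutator_in_so by (auto intro!: lie_algebra_commutator simp: subspace_so)

lemma so_conj_by_aut:
  fixes P :: "real^'n^'n"
  assumes "P ** P = \<epsilon> *\<^sub>R mat 1" "\<epsilon> * \<epsilon> = 1" "transpose P = \<epsilon> *\<^sub>R P"
  shows "lie_aut (so_alg TYPE('n)) (conj_by P)"
  unfolding so_alg_def
  by (rule conj_by_lie_aut[OF assms(1,2)])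
    (auto simp: conj_by_sqrt[OF assms(1,2)] transpose_scaleR matrix_transpose_mul assms
      matmul_bilinear matrix_mul_assoc)

text \<open>A conjugation that fixed all of \<open>\<ss>\<oo>(n)\<close> would be by a scalar matrix.\<close>

lemma so_conj_by_involution:
  fixes P :: "real^'n^'n"
  assumes n: "3 \<le> CARD('n)" and P: "P ** P = \<epsilon> *\<^sub>R mat 1" "\<epsilon> * \<epsilon> = 1" "transpose P = \<epsilon> *\<^sub>R P"
    and "\<And>c. P \<noteq> c *\<^sub>R mat 1"
  shows "lie_involution (so_alg TYPE('n)) (conj_by P)"
proof -
  obtain A where A: "A \<in> carrier (so_alg TYPE('n))" "P ** A \<noteq> A ** P"
    using so_commutant_scalar[OF n, of P] assms by blast
  have "conj_by P A \<noteq> A"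
  proof
    assume "conj_by P A = A"
    then have "P ** A = \<epsilon> *\<^sub>R (P ** (P ** A ** P))"
      by (metis conj_by_sqrt[OF P(1,2)] matmul_scaleR_right)
    also have "\<dots> = A ** P"
      using P by (simp add: matrix_mul_assoc matmul_bilinear)
    finally show False using A by simp
  qed
  then show ?thesis
    using A so_conj_by_aut[OF P] conj_by_sqrt_hom(2)[OF P(1,2)] by (auto simp: lie_involution_def)
qed

section \<open>The unitary Lie algebras\<close>

definition adjoint_mat :: "complex^'n^'m \<Rightarrow> complex^'m^'n" where
  "adjoint_mat A = transpose (map_matrix cnj A)"

lemma adjoint_mat_entry: "adjoint_mat A $ i $ j = cnj (A $ j $ i)"
  by (simp add: adjoint_mat_def transpose_def map_matrix_def)

lemma adjoint_mat_linear:
  "adjoint_mat (A + B) = adjoint_mat A + adjoint_mat B" "adjoint_mat (- A) = - adjoint_mat A"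
  "adjoint_mat (A - B) = adjoint_mat A - adjoint_mat B" "adjoint_mat (r *\<^sub>R A) = r *\<^sub>R adjoint_mat A"
  "adjoint_mat 0 = 0"
  by (simp_all add: vec_eq_iff adjoint_mat_entry)

lemma adjoint_mat_mult: "adjoint_mat (A ** B) = adjoint_mat B ** adjoint_mat A"
  by (simp add: vec_eq_iff adjoint_mat_entry matrix_matrix_mult_def mult.commute)

lemma adjoint_mat_adjoint [simp]: "adjoint_mat (adjoint_mat A) = A"
  by (simp add: vec_eq_iff adjoint_mat_entry)

lemma linear_map_cnj: "linear (map_matrix cnj :: complex^'n^'m \<Rightarrow> complex^'n^'m)"
  by (rule linearI) (simp_all add: vec_eq_iff map_matrix_def)

lemma trace_linear: "trace (r *\<^sub>R A) = r *\<^sub>R trace A" "trace (- A) = - trace A"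
  for A :: "complex^'n^'n"
  by (simp_all add: trace_def scaleR_sum_right sum_negf)

lemma su_carrier: "A \<in> carrier (su_alg T) \<longleftrightarrow> adjoint_mat A = - A \<and> trace A = 0"
  by (simp add: su_alg_def adjoint_mat_def)

lemma su_alg_eq: "su_alg T = \<lparr>carrier = carrier (su_alg T), bracket = commutator\<rparr>"
  by (simp add: su_alg_def)

lemma subspace_su: "subspace (carrier (su_alg T))"
  by (simp add: subspace_def su_carrier adjoint_mat_linear trace_linear trace_add)
    (simp add: trace_def)

lemma commutator_in_su:
  assumes "x \<in> carrier (su_alg T)" "y \<in> carrier (su_alg T)"
  shows "commutator x y \<in> carrier (su_alg T)"
  using assms trace_mul_sym[of x y]
  by (simp add: su_carrier commutator_def adjoint_mat_linear adjoint_mat_mult matmul_bilinear trace_sub)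

lemma inner_matmul_complex:
  fixes x y z :: "complex^'n^'n"
  shows "(x ** y) \<bullet> z = y \<bullet> (adjoint_mat x ** z)" "(x ** y) \<bullet> z = x \<bullet> (z ** adjoint_mat y)"
proof -
  have c: "(a * b) \<bullet> c = b \<bullet> (cnj a * c)" "(a * b) \<bullet> c = a \<bullet> (c * cnj b)" for a b c :: complex
    by (simp_all add: inner_complex_def algebra_simps)
  have "(x ** y) \<bullet> z = (\<Sum>i\<in>UNIV. \<Sum>j\<in>UNIV. \<Sum>k\<in>UNIV. (x$i$k * y$k$j) \<bullet> z$i$j)"
    by (simp add: inner_vec_def matrix_matrix_mult_def inner_sum_left)
  moreover have "\<dots> = (\<Sum>k\<in>UNIV. \<Sum>j\<in>UNIV. \<Sum>i\<in>UNIV. (x$i$k * y$k$j) \<bullet> z$i$j)"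
    by (subst sum.swap, subst (2) sum.swap, subst sum.swap) (rule refl)
  moreover have "\<dots> = y \<bullet> (adjoint_mat x ** z)"
    by (simp add: inner_vec_def matrix_matrix_mult_def inner_sum_right adjoint_mat_entry c(1))
  moreover have "(\<Sum>i\<in>UNIV. \<Sum>j\<in>UNIV. \<Sum>k\<in>UNIV. (x$i$k * y$k$j) \<bullet> z$i$j) =
      (\<Sum>i\<in>UNIV. \<Sum>k\<in>UNIV. \<Sum>j\<in>UNIV. (x$i$k * y$k$j) \<bullet> z$i$j)"
    by (subst (2) sum.swap) (rule refl)
  moreover have "\<dots> = x \<bullet> (z ** adjoint_mat y)"
    by (simp add: inner_vec_def matrix_matrix_mult_def inner_sum_right adjoint_mat_entry c(2))
  ultimately show "(x ** y) \<bullet> z = y \<bullet> (adjoint_mat x ** z)" "(x ** y) \<bullet> z = x \<bullet> (z ** adjoint_mat y)"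
    by simp_all
qed

text \<open>The centre of a subalgebra of \<open>\<ss>\<uu>(m)\<close> that is isomorphic to some \<open>\<ss>\<oo>(n)\<close> is read off from \<open>\<ss>\<oo>(n)\<close>.\<close>

lemma compact_semisimple_if_iso_so:
  fixes V :: "(complex^'m^'m) set" and \<psi> :: "real^'n^'n \<Rightarrow> complex^'m^'m"
  assumes n: "3 \<le> CARD('n)" and V: "subspace V" "\<And>x y. x \<in> V \<Longrightarrow> y \<in> V \<Longrightarrow> commutator x y \<in> V"
    "V \<subseteq> carrier (su_alg TYPE('m))"
    and \<psi>: "lie_iso (so_alg TYPE('n)) \<lparr>carrier = V, bracket = commutator\<rparr> \<psi>"
  shows "compact_semisimple \<lparr>carrier = V, bracket = commutator\<rparr>"
proof (rule compact_semisimple_commutator[OF V(1,2)])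
  fix x y z :: "complex^'m^'m" assume "x \<in> V"
  then have x: "adjoint_mat x = - x"
    using V(3) by (auto simp: su_carrier)
  show "commutator x y \<bullet> z = - (y \<bullet> commutator x z)"
    by (simp add: commutator_def inner_diff_left inner_diff_right matmul_bilinear x
        inner_matmul_complex(1)[of x y z] inner_matmul_complex(2)[of y x z])
next
  fix x assume x: "x \<in> V" and comm: "\<And>y. y \<in> V \<Longrightarrow> commutator x y = 0"
  let ?so = "carrier (so_alg TYPE('n))"
  have \<psi>': "inj_on \<psi> ?so" "\<psi> ` ?so = V"
    "\<And>A B. A \<in> ?so \<Longrightarrow> B \<in> ?so \<Longrightarrow> \<psi> (commutator A B) = commutator (\<psi> A) (\<psi> B)"
    "\<And>A r. A \<in> ?so \<Longrightarrow> \<psi> (r *\<^sub>R A) = r *\<^sub>R \<psi> A"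
    using \<psi> by (auto simp: lie_iso_def bij_betw_def so_alg_def)
  have "0 \<in> ?so"
    using subspace_0[OF subspace_so] by (simp add: so_alg_def)
  then have \<psi>0: "\<psi> 0 = 0"
    using \<psi>'(4)[of 0 0] by simp
  obtain A where A: "A \<in> ?so" "x = \<psi> A"
    using x \<psi>'(2) by auto
  have "commutator A B = 0" if B: "B \<in> ?so" for B
  proof -
    have "\<psi> (commutator A B) = \<psi> 0"
      using A B comm \<psi>' \<psi>0 by (metis image_eqI)
    then show ?thesis
      using inj_onD[OF \<psi>'(1)] commutator_in_so[of A B] A B \<open>0 \<in> ?so\<close>
      by (simp add: so_carrier)
  qed
  then have "A = 0"
    using so_centre[OF n A(1)] by blast
  then show "x = 0"
    using A \<psi>0 by simp
qed

section \<open>The spin representation of a Clifford family\<close>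

lemma matmul_entry: "(A ** B) $ i $ j = (\<Sum>k\<in>UNIV. A $ i $ k * B $ k $ j)"
  by (simp add: matrix_matrix_mult_def)

text \<open>Two families with these relations are the off-diagonal blocks of anticommuting square roots of \<open>1\<close>,
  the generators of a Clifford algebra.  The matrix \<open>spin_map s t A\<close> below is the action of
  \<open>A \<in> \<ss>\<oo>(n)\<close> on one of the two blocks, and \<open>spin_map t s A\<close> is its action on the other one.\<close>

locale clifford_family =
  fixes s t :: "'n::finite \<Rightarrow> ('k::{comm_ring_1,real_algebra_1,euclidean_space})^'m^'m"
  assumes ts: "t i ** s j + t j ** s i = (if i = j then 2 *\<^sub>R mat 1 else 0)"
    and st: "s i ** t j + s j ** t i = (if i = j then 2 *\<^sub>R mat 1 else 0)"

definition spin_map ::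
  "('n::finite \<Rightarrow> ('k::{comm_ring_1,real_algebra_1,euclidean_space})^'m^'m) \<Rightarrow> ('n \<Rightarrow> 'k^'m^'m) \<Rightarrow>
    real^'n^'n \<Rightarrow> 'k^'m^'m" where
  "spin_map s t A = (1 / 4) *\<^sub>R (\<Sum>i\<in>UNIV. \<Sum>j\<in>UNIV. A $ i $ j *\<^sub>R (t i ** s j))"

lemma linear_spin_map: "linear (spin_map s t)"
  by (rule linearI)
    (simp_all add: spin_map_def scaleR_add_left scaleR_add_right sum.distrib scaleR_sum_right mult_ac)

lemma clifford_family_swap: "clifford_family s t \<Longrightarrow> clifford_family t s"
  by (simp add: clifford_family_def)

context clifford_family
begin

text \<open>The two half-spin actions differ by the vector action when they pass \<open>t k\<close>: the matrices
  \<open>t k\<close> transform as the standard basis of \<open>\<real>\<^sup>n\<close>.\<close>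

lemma spin_map_vector_action:
  assumes A: "transpose A = - A"
  shows "spin_map s t A ** t k - t k ** spin_map t s A = (\<Sum>i\<in>UNIV. A $ i $ k *\<^sub>R t i)"
proof -
  have swap: "t i ** s j ** t k - t k ** s i ** t j =
      (if j = k then 2 *\<^sub>R t i else 0) - (if i = k then 2 *\<^sub>R t j else 0)" for i j
  proof -
    have "s j ** t k = (if j = k then 2 *\<^sub>R mat 1 else 0) - s k ** t j"
      using st[of j k] by (simp add: eq_diff_eq)
    then have "t i ** s j ** t k = (if j = k then 2 *\<^sub>R t i else 0) - t i ** s k ** t j"
      by (simp add: matrix_mul_assoc[symmetric] matmul_bilinear)
    moreover have "t i ** s k = (if i = k then 2 *\<^sub>R mat 1 else 0) - t k ** s i"
      using ts[of i k] by (simp add: eq_diff_eq)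
    ultimately show ?thesis
      by (simp add: matmul_bilinear)
  qed
  have "spin_map s t A ** t k - t k ** spin_map t s A =
      (1 / 4) *\<^sub>R (\<Sum>i\<in>UNIV. \<Sum>j\<in>UNIV. A $ i $ j *\<^sub>R (t i ** s j ** t k - t k ** s i ** t j))"
    by (simp add: spin_map_def matmul_bilinear matmul_sum_left matmul_sum_right matrix_mul_assoc
        scaleR_right_diff_distrib sum_subtractf)
  also have "\<dots> = (1 / 4) *\<^sub>R ((\<Sum>i\<in>UNIV. A $ i $ k *\<^sub>R 2 *\<^sub>R t i) - (\<Sum>j\<in>UNIV. A $ k $ j *\<^sub>R 2 *\<^sub>R t j))"
  proof -
    have "(\<Sum>i\<in>UNIV. \<Sum>j\<in>UNIV. A $ i $ j *\<^sub>R (if j = k then 2 *\<^sub>R t i else 0)) =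
        (\<Sum>i\<in>UNIV. A $ i $ k *\<^sub>R 2 *\<^sub>R t i)"
      by (simp add: if_distrib[of "(*\<^sub>R) x" for x] cong: if_cong)
    moreover have "(\<Sum>i\<in>UNIV. \<Sum>j\<in>UNIV. A $ i $ j *\<^sub>R (if i = k then 2 *\<^sub>R t j else 0)) =
        (\<Sum>j\<in>UNIV. A $ k $ j *\<^sub>R 2 *\<^sub>R t j)"
      by (subst sum.swap) (simp add: if_distrib[of "(*\<^sub>R) x" for x] cong: if_cong)
    ultimately show ?thesis
      unfolding swap scaleR_right_diff_distrib sum_subtractf by (simp only:)
  qed
  also have "(\<Sum>j\<in>UNIV. A $ k $ j *\<^sub>R 2 *\<^sub>R t j) = - (\<Sum>i\<in>UNIV. A $ i $ k *\<^sub>R 2 *\<^sub>R t i)"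
    unfolding sum_negf[symmetric] by (intro sum.cong refl, subst so_entry[OF A]) simp
  finally show ?thesis
    by (simp add: scaleR_sum_right scaleR_add_right flip: sum.distrib scaleR_add_left)
qed

text \<open>The vector action, applied to both factors, shows that \<open>ad (spin_map s t A)\<close> acts on the products
  \<open>t\<^sub>k s\<^sub>l\<close> as \<open>A\<close> acts on a tensor with two indices, and for the coefficients \<open>B\<close> of such a tensor this
  is \<open>B \<mapsto> A B - B A\<close>.\<close>

lemma spin_map_hom:
  assumes A: "transpose A = - A"
  shows "spin_map s t (commutator A B) = commutator (spin_map s t A) (spin_map s t B)"
proof -
  interpret sw: clifford_family t s
    by (rule clifford_family_swap) unfold_locales
  define S where "S = spin_map s t A"
  define S' where "S' = spin_map t s A"
  have gen: "commutator S (t k ** s l) =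
      (\<Sum>i\<in>UNIV. A $ i $ k *\<^sub>R (t i ** s l)) + (\<Sum>i\<in>UNIV. A $ i $ l *\<^sub>R (t k ** s i))" for k l
  proof -
    have "commutator S (t k ** s l) = (S ** t k - t k ** S') ** s l + t k ** (S' ** s l - s l ** S)"
      by (simp add: commutator_def matmul_bilinear matrix_mul_assoc)
    also have "\<dots> = (\<Sum>i\<in>UNIV. A $ i $ k *\<^sub>R t i) ** s l + t k ** (\<Sum>i\<in>UNIV. A $ i $ l *\<^sub>R s i)"
      unfolding S_def S'_def spin_map_vector_action[OF A] sw.spin_map_vector_action[OF A] ..
    finally show ?thesis
      by (simp add: matmul_sum_left matmul_sum_right matmul_bilinear)
  qed
  have "commutator S (spin_map s t B) =
      (1 / 4) *\<^sub>R (\<Sum>k\<in>UNIV. \<Sum>l\<in>UNIV. B $ k $ l *\<^sub>R commutator S (t k ** s l))"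
    by (simp add: spin_map_def linear_scale[OF linear_commutator] linear_sum[OF linear_commutator])
  also have "(\<Sum>k\<in>UNIV. \<Sum>l\<in>UNIV. B $ k $ l *\<^sub>R commutator S (t k ** s l)) =
      (\<Sum>k\<in>UNIV. \<Sum>l\<in>UNIV. \<Sum>i\<in>UNIV. (A $ i $ k * B $ k $ l) *\<^sub>R (t i ** s l))
      + (\<Sum>k\<in>UNIV. \<Sum>l\<in>UNIV. \<Sum>i\<in>UNIV. (B $ k $ l * A $ i $ l) *\<^sub>R (t k ** s i))"
    by (simp add: gen scaleR_add_right sum.distrib scaleR_sum_right mult.commute)
  also have "(\<Sum>k\<in>UNIV. \<Sum>l\<in>UNIV. \<Sum>i\<in>UNIV. (A $ i $ k * B $ k $ l) *\<^sub>R (t i ** s l)) =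
      (\<Sum>i\<in>UNIV. \<Sum>l\<in>UNIV. (A ** B) $ i $ l *\<^sub>R (t i ** s l))"
    by (subst (2) sum.swap, subst sum.swap, subst (2) sum.swap)
      (simp add: matmul_entry scaleR_sum_left)
  also have "(\<Sum>k\<in>UNIV. \<Sum>l\<in>UNIV. \<Sum>i\<in>UNIV. (B $ k $ l * A $ i $ l) *\<^sub>R (t k ** s i)) =
      (\<Sum>k\<in>UNIV. \<Sum>l\<in>UNIV. \<Sum>i\<in>UNIV. - ((B $ k $ l * A $ l $ i) *\<^sub>R (t k ** s i)))"
    by (intro sum.cong refl, subst so_entry[OF A]) simp
  also have "\<dots> = - (\<Sum>k\<in>UNIV. \<Sum>i\<in>UNIV. (B ** A) $ k $ i *\<^sub>R (t k ** s i))"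
    by (simp add: matmul_entry scaleR_sum_left sum_negf) (rule sum.cong[OF refl sum.swap])
  finally show ?thesis
    by (simp add: S_def spin_map_def commutator_def scaleR_left_diff_distrib sum_subtractf)
qed

text \<open>The product of \<open>\<Sum> v\<^sub>i t\<^sub>i\<close> and \<open>\<Sum> v\<^sub>j s\<^sub>j\<close> is \<open>\<bar>v\<bar>\<^sup>2\<close>.\<close>

lemma clifford_vector_inj:
  assumes "(\<Sum>i\<in>UNIV. v i *\<^sub>R t i) = 0"
  shows "v k = 0"
proof -
  have expand: "(\<Sum>i\<in>UNIV. \<Sum>j\<in>UNIV. (v i * v j) *\<^sub>R (t i ** s j)) = 0"
  proof -
    have "(\<Sum>i\<in>UNIV. v i *\<^sub>R t i) ** (\<Sum>j\<in>UNIV. v j *\<^sub>R s j) =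
        (\<Sum>i\<in>UNIV. \<Sum>j\<in>UNIV. (v i * v j) *\<^sub>R (t i ** s j))"
      by (simp only: matmul_sum_left, simp only: matmul_sum_right)
        (simp add: matmul_bilinear mult.commute)
    then show ?thesis
      by (simp add: assms matmul_bilinear)
  qed
  moreover have "(\<Sum>i\<in>UNIV. \<Sum>j\<in>UNIV. (v i * v j) *\<^sub>R (t j ** s i)) = 0"
    by (subst sum.swap) (use expand in \<open>simp add: mult.commute\<close>)
  ultimately have "0 = (\<Sum>i\<in>UNIV. \<Sum>j\<in>UNIV. (v i * v j) *\<^sub>R (t i ** s j))
      + (\<Sum>i\<in>UNIV. \<Sum>j\<in>UNIV. (v i * v j) *\<^sub>R (t j ** s i))"
    by simp
  also have "\<dots> = (\<Sum>i\<in>UNIV. \<Sum>j\<in>UNIV. (v i * v j) *\<^sub>R (if i = j then 2 *\<^sub>R mat 1 else 0))"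
    by (simp add: ts flip: sum.distrib scaleR_add_right)
  also have "\<dots> = (2 * (\<Sum>i\<in>UNIV. (v i)\<^sup>2)) *\<^sub>R mat 1"
    by (simp add: if_distrib[of "(*\<^sub>R) x" for x] power2_eq_square scaleR_sum_left sum_distrib_left mult_ac
        cong: if_cong)
  finally have "(2 * (\<Sum>i\<in>UNIV. (v i)\<^sup>2)) *\<^sub>R (mat 1 :: 'k^'m^'m) = 0"
    by simp
  then have "(\<Sum>i\<in>UNIV. (v i)\<^sup>2) = 0"
    by (simp add: vec_eq_iff mat_def split: if_splits)
  then show ?thesis
    by (simp add: sum_nonneg_eq_0_iff)
qed

text \<open>If one of the two block actions of \<open>A\<close> vanishes, summing the vector action over all \<open>k\<close> gives \<open>n\<close>
  times the other block action on one side and \<open>4\<close> times it on the other side.  So both vanish,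
  hence also the vector action, which is faithful.\<close>

lemma spin_map_kernel:
  assumes n: "CARD('n) \<noteq> 4" and A: "transpose A = - A" and zero: "spin_map s t A = 0"
  shows "A = 0"
proof -
  interpret sw: clifford_family t s
    by (rule clifford_family_swap) unfold_locales
  have sq: "s k ** t k = mat 1" for k
    using st[of k k] by (simp flip: scaleR_2)
  have "spin_map t s A = (\<Sum>i\<in>UNIV. A $ i $ k *\<^sub>R (s i ** t k))" for k
  proof -
    have "spin_map t s A = (spin_map t s A ** s k - s k ** spin_map s t A) ** t k"
      by (simp add: zero matmul_bilinear matrix_mul_assoc[symmetric] sq)
    also have "\<dots> = (\<Sum>i\<in>UNIV. A $ i $ k *\<^sub>R (s i ** t k))"
      by (simp add: sw.spin_map_vector_action[OF A] matmul_sum_left matmul_bilinear)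
    finally show ?thesis .
  qed
  then have "(\<Sum>k\<in>(UNIV :: 'n set). spin_map t s A) = (\<Sum>k\<in>UNIV. \<Sum>i\<in>UNIV. A $ i $ k *\<^sub>R (s i ** t k))"
    by (intro sum.cong) auto
  also have "\<dots> = 4 *\<^sub>R spin_map t s A"
    by (subst sum.swap) (simp add: spin_map_def)
  finally have "(real CARD('n) - 4) *\<^sub>R spin_map t s A = 0"
    by (simp only: scaleR_left_diff_distrib sum_constant_scaleR right_minus_eq)
  then have "spin_map t s A = 0"
    using n by auto
  then have "(\<Sum>i\<in>UNIV. A $ i $ k *\<^sub>R t i) = 0" for k
    using spin_map_vector_action[OF A, of k] zero by (simp add: matmul_bilinear)
  then have "A $ i $ k = 0" for i k
    using clifford_vector_inj[of "\<lambda>i. A $ i $ k"] by blast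
  then show ?thesis
    by (simp add: vec_eq_iff)
qed

lemma spin_map_inj:
  assumes "CARD('n) \<noteq> 4"
  shows "inj_on (spin_map s t) (carrier (so_alg TYPE('n)))"
proof (rule inj_onI)
  fix A B assume "A \<in> carrier (so_alg TYPE('n))" "B \<in> carrier (so_alg TYPE('n))"
    "spin_map s t A = spin_map s t B"
  then have "spin_map s t (A - B) = 0" "transpose (A - B) = - (A - B)"
    by (simp_all add: so_carrier transpose_linear linear_diff[OF linear_spin_map])
  then show "A = B"
    using spin_map_kernel[OF assms] by force
qed

lemma spin_map_lie_iso:
  assumes "CARD('n) \<noteq> 4" "spin_map s t ` carrier (so_alg TYPE('n)) = V"
  shows "lie_iso (so_alg TYPE('n)) \<lparr>carrier = V, bracket = commutator\<rparr> (spin_map s t)"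
  using spin_map_inj[OF assms(1)] spin_map_hom assms(2)
  by (auto simp: lie_iso_def bij_betw_def so_alg_def linear_add[OF linear_spin_map]
      linear_scale[OF linear_spin_map])

end

lemma spin_map_in_subspace:
  assumes V: "subspace V" and ts: "\<And>i j. i \<noteq> j \<Longrightarrow> t i ** s j \<in> V" and A: "A \<in> carrier (so_alg T)"
  shows "spin_map s t A \<in> V"
proof -
  have *: "A $ i $ j *\<^sub>R (t i ** s j) \<in> V" for i j
    using ts[of i j] V so_entry[of A i i] A subspace_scale[OF V] subspace_0[OF V]
    by (cases "i = j") (auto simp: so_carrier)
  show ?thesis
    unfolding spin_map_def by (rule subspace_scale[OF V], intro subspace_sum[OF V] *)
qed

text \<open>The hypothesis holds when \<open>h\<close> is multiplicative and permutes the \<open>t\<^sub>k\<close> and the \<open>s\<^sub>k\<close> up to sign.  It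
  speaks of the products only, because common scalar factors such as \<open>\<i>\<close> and \<open>- \<i>\<close> may occur and
  cancel.\<close>

lemma spin_map_equivariant:
  assumes h: "linear h" and \<pi>: "\<And>k. \<pi> (\<pi> k) = k"
    and eq: "\<And>k l. h (t (\<pi> k) ** s (\<pi> l)) = (\<eta> k * \<eta> l) *\<^sub>R (t k ** s l)"
  shows "h (spin_map s t A) = spin_map s t (\<chi> k l. \<eta> k * \<eta> l * A $ \<pi> k $ \<pi> l)"
proof -
  have bij: "bij \<pi>"
    using \<pi> by (rule involuntory_imp_bij)
  have "h (spin_map s t A) = (1 / 4) *\<^sub>R (\<Sum>i\<in>UNIV. \<Sum>j\<in>UNIV. A $ i $ j *\<^sub>R h (t i ** s j))"
    by (simp add: spin_map_def linear_scale[OF h] linear_sum[OF h])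
  also have "(\<Sum>i\<in>UNIV. \<Sum>j\<in>UNIV. A $ i $ j *\<^sub>R h (t i ** s j)) =
      (\<Sum>k\<in>UNIV. \<Sum>l\<in>UNIV. A $ \<pi> k $ \<pi> l *\<^sub>R h (t (\<pi> k) ** s (\<pi> l)))"
    by (subst sum.reindex_bij_betw[OF bij, symmetric], subst sum.reindex_bij_betw[OF bij, symmetric])
      (rule refl)
  finally show ?thesis
    by (simp add: spin_map_def eq mult_ac)
qed

lemma spin_map_so_elem:
  assumes "clifford_family s t" "p \<noteq> q"
  shows "spin_map s t (so_elem p q) = (1 / 2) *\<^sub>R (t p ** s q)"
proof -
  have "(\<Sum>i\<in>UNIV. \<Sum>j\<in>UNIV. so_elem p q $ i $ j *\<^sub>R (t i ** s j)) =
      (\<Sum>i\<in>UNIV. \<Sum>j\<in>UNIV. if i = p then if j = q then t i ** s j else 0 else 0)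
      - (\<Sum>i\<in>UNIV. \<Sum>j\<in>UNIV. if i = q then if j = p then t i ** s j else 0 else 0)"
    unfolding sum_subtractf[symmetric] by (intro sum.cong refl) (auto simp: so_elem_def)
  also have "\<dots> = t p ** s q - t q ** s p"
  proof -
    have "(\<Sum>i\<in>UNIV. \<Sum>j\<in>UNIV. if i = a then if j = b then t i ** s j else 0 else 0) = t a ** s b" for a b
    proof -
      have "(\<Sum>j\<in>UNIV. if i = a then if j = b then t i ** s j else 0 else 0) = (if i = a then t i ** s b else 0)" for i
        by simp
      then show ?thesis by simp
    qed
    then show ?thesis by simp
  qed
  also have "\<dots> = 2 *\<^sub>R (t p ** s q)"
    using clifford_family.ts[OF assms(1), of p q] assms(2) by (simp add: scaleR_2 add_eq_0_iff)
  finally show ?thesis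
    by (simp add: spin_map_def)
qed

section \<open>Monomial matrices as lists\<close>

lemma index_pos_less_iff: "index_pos i < index_pos j \<longleftrightarrow> i < j" for i j :: "'n::{finite,linorder}"
proof -
  have "index_pos i < index_pos j" if "i < j" for i j :: 'n
    unfolding index_pos_def using that by (intro psubset_card_mono) auto
  then show ?thesis
    by (metis less_asym linorder_neqE)
qed

lemma index_pos_inj [simp]: "index_pos i = index_pos j \<longleftrightarrow> i = j"
  by (metis index_pos_less_iff less_irrefl linorder_neqE)

lemma index_pos_less [simp]: "index_pos (i :: 'n::{finite,linorder}) < CARD('n)"
  unfolding index_pos_def by (intro psubset_card_mono) auto

lemma bij_index_pos: "bij_betw index_pos (UNIV :: 'n::{finite,linorder} set) {..<CARD('n)}"
proof -
  have "inj (index_pos :: 'n \<Rightarrow> nat)"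
    by (simp add: inj_def)
  moreover have "range (index_pos :: 'n \<Rightarrow> nat) = {..<CARD('n)}"
    using \<open>inj index_pos\<close> by (intro card_subset_eq) (auto simp: card_image)
  ultimately show ?thesis
    by (simp add: bij_betw_def)
qed

definition index_at :: "nat \<Rightarrow> 'n::{finite,linorder}" where
  "index_at r = inv_into UNIV index_pos r"

lemma index_pos_at [simp]: "r < CARD('n) \<Longrightarrow> index_pos (index_at r :: 'n::{finite,linorder}) = r"
  using bij_betw_inv_into_right[OF bij_index_pos] by (simp add: index_at_def)

lemma index_at_pos [simp]: "index_at (index_pos i) = i"
  using bij_betw_inv_into_left[OF bij_index_pos] by (simp add: index_at_def)

lemma index_pos_eq_iff: "r < CARD('n) \<Longrightarrow> index_pos i = r \<longleftrightarrow> (i :: 'n::{finite,linorder}) = index_at r"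
  by auto

lemma sum_index_pos:
  fixes f :: "'n::{finite,linorder} \<Rightarrow> 'b::comm_monoid_add"
  shows "(\<Sum>i\<in>UNIV. f i) = (\<Sum>r<CARD('n). f (index_at r))"
  using sum.reindex_bij_betw[OF bij_index_pos[where 'n = 'n], of "\<lambda>r. f (index_at r)"] by simp

text \<open>The list gives for each row the column and the value of its only nonzero entry.\<close>

definition monomial :: "(nat \<times> 'a) list \<Rightarrow> ('a::zero, 'n::{finite,linorder}) sqmat" where
  "monomial xs = (\<chi> i j. if index_pos j = fst (xs ! index_pos i) then snd (xs ! index_pos i) else 0)"

definition mono_wf :: "nat \<Rightarrow> (nat \<times> 'a) list \<Rightarrow> bool" where
  "mono_wf n xs \<longleftrightarrow> length xs = n \<and> list_all (\<lambda>x. fst x < n) xs"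

definition mono_mul :: "(nat \<times> 'a::times) list \<Rightarrow> (nat \<times> 'a) list \<Rightarrow> (nat \<times> 'a) list" where
  "mono_mul xs ys = map (\<lambda>x. (fst (ys ! fst x), snd x * snd (ys ! fst x))) xs"

definition mono_map :: "('a \<Rightarrow> 'b) \<Rightarrow> (nat \<times> 'a) list \<Rightarrow> (nat \<times> 'b) list" where
  "mono_map f xs = map (\<lambda>x. (fst x, f (snd x))) xs"

definition mono_one :: "nat \<Rightarrow> (nat \<times> 'a::one) list" where
  "mono_one n = map (\<lambda>r. (r, 1)) [0..<n]"

text \<open>Transposition, for tables whose underlying permutation is an involution.\<close>

definition mono_transpose :: "(nat \<times> 'a) list \<Rightarrow> (nat \<times> 'a) list" where
  "mono_transpose xs = map (\<lambda>x. (fst x, snd (xs ! fst x))) xs"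

lemma mono_wf_nth: "mono_wf n xs \<Longrightarrow> r < n \<Longrightarrow> fst (xs ! r) < n"
  by (simp add: mono_wf_def list_all_length)

lemma mono_wf_mul: "mono_wf n xs \<Longrightarrow> mono_wf n ys \<Longrightarrow> mono_wf n (mono_mul xs ys)"
  by (auto simp: mono_wf_def mono_mul_def list_all_length)

lemma monomial_mult_entry:
  fixes M :: "('a::comm_ring_1, 'n::{finite,linorder}) sqmat"
  assumes "mono_wf CARD('n) xs"
  shows "(monomial xs ** M) $ i $ j =
    snd (xs ! index_pos i) * M $ index_at (fst (xs ! index_pos i)) $ j"
proof -
  have "(monomial xs ** M) $ i $ j = (\<Sum>k\<in>UNIV.
      (if k = index_at (fst (xs ! index_pos i)) then snd (xs ! index_pos i) * M $ k $ j else 0))"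
    unfolding matmul_entry
    by (rule sum.cong) (use mono_wf_nth[OF assms index_pos_less, of i] in \<open>simp_all add: monomial_def index_pos_eq_iff\<close>)
  then show ?thesis by simp
qed

lemma monomial_mult:
  assumes "mono_wf CARD('n) xs" "length ys = CARD('n)"
  shows "monomial xs ** monomial ys = (monomial (mono_mul xs ys) :: ('a::comm_ring_1, 'n::{finite,linorder}) sqmat)"
proof -
  have "index_pos i < length xs" for i :: 'n
    using assms(1) by (simp add: mono_wf_def)
  then show ?thesis
    using mono_wf_nth[OF assms(1) index_pos_less]
    by (simp add: vec_eq_iff monomial_mult_entry[OF assms(1)]) (simp add: monomial_def mono_mul_def)
qed

lemma monomial_map:
  assumes "f 0 = 0" "length xs = CARD('n)"
  shows "(\<chi> i j. f ((monomial xs :: ('a::zero, 'n::{finite,linorder}) sqmat) $ i $ j)) = monomial (mono_map f xs)"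
  using assms by (simp add: vec_eq_iff monomial_def mono_map_def)

lemma monomial_scaleR:
  assumes "length xs = CARD('n)"
  shows "r *\<^sub>R monomial xs = (monomial (mono_map (\<lambda>a. r *\<^sub>R a) xs) :: ('a::real_vector, 'n::{finite,linorder}) sqmat)"
  using monomial_map[of "\<lambda>a. r *\<^sub>R a" xs, where ?'n = 'n] assms by (simp add: scaleR_vec_def)

lemma monomial_uminus:
  assumes "length xs = CARD('n)"
  shows "- monomial xs = (monomial (mono_map uminus xs) :: ('a::group_add, 'n::{finite,linorder}) sqmat)"
  using assms by (simp add: vec_eq_iff monomial_def mono_map_def)

lemma monomial_cnj:
  assumes "length xs = CARD('n)"
  shows "map_matrix cnj (monomial xs) = (monomial (mono_map cnj xs) :: (complex, 'n::{finite,linorder}) sqmat)"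
  using assms by (simp add: vec_eq_iff monomial_def mono_map_def map_matrix_def)

lemma monomial_one: "(mat 1 :: ('a::zero_neq_one, 'n::{finite,linorder}) sqmat) = monomial (mono_one CARD('n))"
  by (simp add: vec_eq_iff monomial_def mono_one_def mat_def)

definition mono_invol :: "nat \<Rightarrow> (nat \<times> 'a) list \<Rightarrow> bool" where
  "mono_invol n xs \<longleftrightarrow> length xs = n \<and> (\<forall>r<n. fst (xs ! r) < n \<and> fst (xs ! fst (xs ! r)) = r)"

lemma mono_invol_wf: "mono_invol n xs \<Longrightarrow> mono_wf n xs"
  by (simp add: mono_invol_def mono_wf_def list_all_length)

lemma monomial_transpose:
  assumes "mono_invol CARD('n) xs"
  shows "transpose (monomial xs) = (monomial (mono_transpose xs) :: ('a::zero, 'n::{finite,linorder}) sqmat)"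
proof -
  have "index_pos i = fst (xs ! index_pos j) \<longleftrightarrow> index_pos j = fst (xs ! index_pos i)" for i j :: 'n
    using assms by (metis index_pos_less mono_invol_def)
  then show ?thesis
    using assms by (auto simp: vec_eq_iff transpose_def monomial_def mono_transpose_def mono_invol_def)
qed

lemma adjoint_monomial:
  assumes "mono_invol CARD('n) xs"
  shows "adjoint_mat (monomial xs) = (monomial (mono_transpose (mono_map cnj xs)) :: (complex, 'n::{finite,linorder}) sqmat)"
proof -
  have "mono_invol CARD('n) (mono_map cnj xs)"
    using assms by (simp add: mono_invol_def mono_map_def)
  then show ?thesis
    using assms by (simp add: adjoint_mat_def monomial_cnj monomial_transpose mono_invol_def)
qed

lemma inner_monomial:
  fixes M :: "('a::real_inner, 'n::{finite,linorder}) sqmat"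
  assumes "mono_wf CARD('n) xs"
  shows "monomial xs \<bullet> M = (\<Sum>r<CARD('n). snd (xs ! r) \<bullet> M $ index_at r $ index_at (fst (xs ! r)))"
proof -
  have "(\<Sum>j\<in>UNIV. (monomial xs :: ('a, 'n) sqmat) $ index_at r $ j \<bullet> M $ index_at r $ j) =
      snd (xs ! r) \<bullet> M $ index_at r $ index_at (fst (xs ! r))" if "r < CARD('n)" for r
  proof -
    have "(\<Sum>j\<in>UNIV. (monomial xs :: ('a, 'n) sqmat) $ index_at r $ j \<bullet> M $ index_at r $ j) =
      (\<Sum>j\<in>UNIV. if j = index_at (fst (xs ! r)) then snd (xs ! r) \<bullet> M $ index_at r $ j else 0)"
      by (rule sum.cong) (use mono_wf_nth[OF assms that] that in \<open>simp_all add: monomial_def index_pos_eq_iff\<close>)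
    then show ?thesis by simp
  qed
  then show ?thesis
    by (simp add: inner_vec_def sum_index_pos[where f = "\<lambda>i. \<Sum>j\<in>UNIV. monomial xs $ i $ j \<bullet> M $ i $ j"])
qed

lemma trace_monomial:
  "trace (monomial xs :: ('a::comm_ring_1, 'n::{finite,linorder}) sqmat) =
    (\<Sum>r<CARD('n). if fst (xs ! r) = r then snd (xs ! r) else 0)"
  unfolding trace_def sum_index_pos by (rule sum.cong) (auto simp: monomial_def)

text \<open>The tables of the signed permutation matrices that are symmetric with square \<open>1\<close>
  (\<open>\<epsilon> = 1\<close>) or skew with square \<open>- 1\<close> (\<open>\<epsilon> = - 1\<close>).\<close>

definition mono_sqrt :: "nat \<Rightarrow> real \<Rightarrow> (nat \<times> 'a::real_algebra_1) list \<Rightarrow> bool" where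
  "mono_sqrt n \<epsilon> ps \<longleftrightarrow> mono_invol n ps \<and> \<epsilon> * \<epsilon> = 1 \<and>
     (\<forall>r<n. snd (ps ! fst (ps ! r)) = \<epsilon> *\<^sub>R snd (ps ! r) \<and> snd (ps ! r) * snd (ps ! r) = 1)"

lemma mono_sqrt_square:
  fixes ps :: "(nat \<times> 'a::{comm_ring_1,real_algebra_1}) list"
  assumes "mono_sqrt CARD('n) \<epsilon> ps"
  shows "monomial ps ** monomial ps = \<epsilon> *\<^sub>R (mat 1 :: ('a, 'n::{finite,linorder}) sqmat)"
proof -
  have wf: "mono_wf CARD('n) ps"
    using assms by (simp add: mono_sqrt_def mono_invol_wf)
  have "mono_mul ps ps = mono_map (\<lambda>a. \<epsilon> *\<^sub>R a) (mono_one CARD('n))"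
    using assms
    by (intro nth_equalityI)
      (simp_all add: mono_mul_def mono_map_def mono_one_def mono_sqrt_def mono_invol_def)
  then show ?thesis
    using wf by (simp add: monomial_mult monomial_one monomial_scaleR mono_wf_def mono_one_def)
qed

lemma mono_sqrt_transpose:
  fixes ps :: "(nat \<times> 'a::{comm_ring_1,real_algebra_1}) list"
  assumes "mono_sqrt CARD('n) \<epsilon> ps"
  shows "transpose (monomial ps) = \<epsilon> *\<^sub>R (monomial ps :: ('a, 'n::{finite,linorder}) sqmat)"
proof -
  have "mono_transpose ps = mono_map (\<lambda>a. \<epsilon> *\<^sub>R a) ps"
    using assms
    by (intro nth_equalityI) (simp_all add: mono_transpose_def mono_map_def mono_sqrt_def mono_invol_def)
  then show ?thesis
    using assms by (simp add: monomial_transpose monomial_scaleR mono_sqrt_def mono_invol_def)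
qed

text \<open>The table of \<open>P Z P\<^sup>-\<^sup>1\<close> when \<open>P\<^sup>2 = \<epsilon>\<close>.\<close>

definition mono_conj ::
  "real \<Rightarrow> (nat \<times> 'a::real_algebra_1) list \<Rightarrow> (nat \<times> 'a) list \<Rightarrow> (nat \<times> 'a) list" where
  "mono_conj \<epsilon> ps xs = mono_map (\<lambda>a. \<epsilon> *\<^sub>R a) (mono_mul ps (mono_mul xs ps))"

lemma conj_by_monomial:
  fixes ps :: "(nat \<times> 'a::{comm_ring_1,real_algebra_1,euclidean_space}) list"
  assumes ps: "mono_sqrt CARD('n) \<epsilon> ps" and xs: "mono_wf CARD('n) xs"
  shows "conj_by (monomial ps) (monomial xs) = (monomial (mono_conj \<epsilon> ps xs) :: ('a, 'n::{finite,linorder}) sqmat)"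
proof -
  have wf: "mono_wf CARD('n) ps" "mono_wf CARD('n) (mono_mul xs ps)" "mono_wf CARD('n) (mono_mul ps (mono_mul xs ps))"
    using ps xs by (simp_all add: mono_sqrt_def mono_invol_wf mono_wf_mul)
  have len: "length ps = CARD('n)" "length (mono_mul xs ps) = CARD('n)" "length (mono_mul ps (mono_mul xs ps)) = CARD('n)"
    using wf by (auto simp: mono_wf_def)
  have "\<epsilon> * \<epsilon> = 1"
    using ps by (simp add: mono_sqrt_def)
  then show ?thesis
    using wf xs len
    by (simp add: conj_by_sqrt[OF mono_sqrt_square[OF ps]] mono_conj_def monomial_scaleR[symmetric]
        monomial_mult[symmetric] matrix_mul_assoc)
qed

lemma linear_conj_by_monomial:
  fixes ps :: "(nat \<times> 'a::{comm_ring_1,real_algebra_1,euclidean_space}) list"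
  assumes "mono_sqrt CARD('n) \<epsilon> ps"
  shows "linear (conj_by (monomial ps :: ('a, 'n::{finite,linorder}) sqmat))"
  using conj_by_sqrt_hom(1)[OF mono_sqrt_square[OF assms]] assms by (simp add: mono_sqrt_def)

text \<open>The inverse of a signed permutation matrix is its transpose.\<close>

lemma conj_by_signed_permutation:
  fixes A :: "(real, 'n::{finite,linorder}) sqmat"
  assumes ps: "mono_sqrt CARD('n) \<epsilon> ps"
  shows "conj_by (monomial ps) A = (\<chi> k l. snd (ps ! index_pos k) * snd (ps ! index_pos l) *
    A $ index_at (fst (ps ! index_pos k)) $ index_at (fst (ps ! index_pos l)))"
proof -
  have wf: "mono_wf CARD('n) ps" and \<epsilon>: "\<epsilon> * \<epsilon> = 1"
    using ps by (simp_all add: mono_sqrt_def mono_invol_wf)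
  have "conj_by (monomial ps) A = monomial ps ** (A ** transpose (monomial ps))"
    by (simp add: conj_by_sqrt[OF mono_sqrt_square[OF ps] \<epsilon>] mono_sqrt_transpose[OF ps] matmul_bilinear
        matrix_mul_assoc)
  also have "A ** transpose (monomial ps) = transpose (monomial ps ** transpose A)"
    by (simp add: matrix_transpose_mul)
  finally show ?thesis
    by (simp add: vec_eq_iff monomial_mult_entry[OF wf]) (simp add: transpose_def monomial_mult_entry[OF wf])
qed

definition mono_scalar :: "(nat \<times> 'a) list \<Rightarrow> bool" where
  "mono_scalar xs \<longleftrightarrow> (\<exists>c. \<forall>r<length xs. xs ! r = (r, c))"

lemma so_involution_monomial:
  assumes "3 \<le> CARD('n)" and ps: "mono_sqrt CARD('n) \<epsilon> ps" and ns: "\<not> mono_scalar ps"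
  shows "lie_involution (so_alg TYPE('n::{finite,linorder})) (conj_by (monomial ps))"
proof (rule so_conj_by_involution[OF assms(1) mono_sqrt_square[OF ps] _ mono_sqrt_transpose[OF ps]])
  show "\<epsilon> * \<epsilon> = 1"
    using ps by (simp add: mono_sqrt_def)
  show "monomial ps \<noteq> c *\<^sub>R (mat 1 :: (real, 'n) sqmat)" for c
  proof
    assume eq: "monomial ps = c *\<^sub>R (mat 1 :: (real, 'n) sqmat)"
    have "ps ! r = (r, c)" if r: "r < length ps" for r
    proof -
      have len: "length ps = CARD('n)" and f: "fst (ps ! r) < CARD('n)" and nz: "snd (ps ! r) * snd (ps ! r) = 1"
        using ps r by (auto simp: mono_sqrt_def mono_invol_def)
      have "(monomial ps :: (real, 'n) sqmat) $ index_at r $ index_at (fst (ps ! r)) =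
          (c *\<^sub>R mat 1 :: (real, 'n) sqmat) $ index_at r $ index_at (fst (ps ! r))"
        using eq by simp
      then have s: "snd (ps ! r) = (if (index_at r :: 'n) = index_at (fst (ps ! r)) then c else 0)"
        using f r len by (simp add: monomial_def mat_def)
      then have "(index_at r :: 'n) = index_at (fst (ps ! r))"
        using nz by (auto split: if_splits)
      then have "r = fst (ps ! r)"
        using f r len by (metis index_pos_at)
      with s show ?thesis
        by (metis prod.collapse)
    qed
    then show False
      using ns by (auto simp: mono_scalar_def)
  qed
qed

section \<open>Clifford families from tables\<close>

definition family ::
  "(nat \<times> 'a) list list \<Rightarrow> 'n::{finite,linorder} \<Rightarrow> ('a::zero, 'm::{finite,linorder}) sqmat" where
  "family ss i = monomial (ss ! index_pos i)"

definition clifford_table ::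
  "nat \<Rightarrow> nat \<Rightarrow> (nat \<times> 'a::comm_ring_1) list list \<Rightarrow> (nat \<times> 'a) list list \<Rightarrow> bool" where
  "clifford_table n m ss ts \<longleftrightarrow> length ss = n \<and> length ts = n \<and>
     list_all (mono_wf m) ss \<and> list_all (mono_wf m) ts \<and>
     (\<forall>i<n. \<forall>j<n.
        mono_mul (ts ! i) (ss ! j) = (if i = j then mono_one m else mono_map uminus (mono_mul (ts ! j) (ss ! i))) \<and>
        mono_mul (ss ! i) (ts ! j) = (if i = j then mono_one m else mono_map uminus (mono_mul (ss ! j) (ts ! i))))"

lemma clifford_table_wf:
  assumes "clifford_table CARD('n) m ss ts"
  shows "mono_wf m (ss ! index_pos (i :: 'n::{finite,linorder}))" "mono_wf m (ts ! index_pos i)"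
  using assms by (simp_all add: clifford_table_def list_all_length)

lemma family_mult:
  assumes "clifford_table CARD('n) CARD('m) ss ts"
  shows "family ts i ** family ss j = (monomial (mono_mul (ts ! index_pos (i :: 'n::{finite,linorder})) (ss ! index_pos (j :: 'n)))
    :: ('a::comm_ring_1, 'm::{finite,linorder}) sqmat)"
    "family ss i ** family ts j = (monomial (mono_mul (ss ! index_pos i) (ts ! index_pos j))
    :: ('a, 'm) sqmat)"
  using clifford_table_wf[OF assms] by (simp_all add: family_def monomial_mult mono_wf_def)

lemma clifford_family_table:
  fixes ss :: "(nat \<times> 'a::{comm_ring_1,real_algebra_1,euclidean_space}) list list"
  assumes tab: "clifford_table CARD('n) CARD('m) ss ts"
  shows "clifford_family (family ss :: 'n::{finite,linorder} \<Rightarrow> ('a, 'm::{finite,linorder}) sqmat) (family ts)"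
proof -
  have len: "length (mono_mul (ts ! index_pos i) (ss ! index_pos j)) = CARD('m)"
    "length (mono_mul (ss ! index_pos i) (ts ! index_pos j)) = CARD('m)" for i j :: 'n
    using clifford_table_wf[OF tab] by (simp_all add: mono_wf_mul mono_wf_def mono_mul_def)
  have rel: "mono_mul (ts ! index_pos i) (ss ! index_pos j) =
      (if i = j then mono_one CARD('m) else mono_map uminus (mono_mul (ts ! index_pos j) (ss ! index_pos i)))"
    "mono_mul (ss ! index_pos i) (ts ! index_pos j) =
      (if i = j then mono_one CARD('m) else mono_map uminus (mono_mul (ss ! index_pos j) (ts ! index_pos i)))"
    for i j :: 'n
    using tab index_pos_less[of i] index_pos_less[of j] unfolding clifford_table_def by (metis index_pos_inj)+
  show ?thesis
  proof
    fix i j :: 'n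
    show "family ts i ** family ss j + family ts j ** family ss i =
        (if i = j then 2 *\<^sub>R mat 1 else (0 :: ('a, 'm) sqmat))"
      using rel(1)[of i j] by (cases "i = j") (simp_all add: family_mult[OF tab] monomial_one
          monomial_uminus[OF len(1), symmetric] scaleR_2)
    show "family ss i ** family ts j + family ss j ** family ts i =
        (if i = j then 2 *\<^sub>R mat 1 else (0 :: ('a, 'm) sqmat))"
      using rel(2)[of i j] by (cases "i = j") (simp_all add: family_mult[OF tab] monomial_one
          monomial_uminus[OF len(2), symmetric] scaleR_2)
  qed
qed

definition table_equivariant ::
  "nat \<Rightarrow> ((nat \<times> 'a) list \<Rightarrow> (nat \<times> 'a) list) \<Rightarrow> (nat \<times> real) list \<Rightarrow>
    (nat \<times> 'a::{times,real_vector}) list list \<Rightarrow> (nat \<times> 'a) list list \<Rightarrow> bool" where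
  "table_equivariant n H ps ss ts \<longleftrightarrow> (\<forall>k<n. \<forall>l<n.
     H (mono_mul (ts ! fst (ps ! k)) (ss ! fst (ps ! l))) =
     mono_map (\<lambda>a. (snd (ps ! k) * snd (ps ! l)) *\<^sub>R a) (mono_mul (ts ! k) (ss ! l)))"

text \<open>On tables, equivariance is a comparison of the \<open>n\<^sup>2\<close> products \<open>t\<^sub>k s\<^sub>l\<close>.\<close>

lemma spin_map_equivariant_table:
  fixes h :: "('a::{comm_ring_1,real_algebra_1,euclidean_space}, 'm::{finite,linorder}) sqmat \<Rightarrow> ('a, 'm) sqmat"
    and A :: "(real, 'n::{finite,linorder}) sqmat"
  assumes tab: "clifford_table CARD('n) CARD('m) ss ts" and ps: "mono_sqrt CARD('n) \<epsilon> ps"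
    and h: "linear h" and H: "\<And>xs. mono_wf CARD('m) xs \<Longrightarrow> h (monomial xs) = monomial (H xs)"
    and eq: "table_equivariant CARD('n) H ps ss ts"
  shows "h (spin_map (family ss) (family ts) A) = spin_map (family ss) (family ts) (conj_by (monomial ps) A)"
  unfolding conj_by_signed_permutation[OF ps]
proof (rule spin_map_equivariant[OF h])
  have ps': "fst (ps ! index_pos k) < CARD('n)" "fst (ps ! fst (ps ! index_pos k)) = index_pos k" for k :: 'n
    using ps by (auto simp: mono_sqrt_def mono_invol_def)
  fix k l :: 'n
  let ?\<pi> = "\<lambda>k :: 'n. index_at (fst (ps ! index_pos k)) :: 'n"
  show "?\<pi> (?\<pi> k) = k"
    by (simp add: ps')
  have "mono_wf CARD('m) (mono_mul (ts ! index_pos (?\<pi> k)) (ss ! index_pos (?\<pi> l)))"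
    by (rule mono_wf_mul[OF clifford_table_wf(2)[OF tab] clifford_table_wf(1)[OF tab]])
  moreover have "length (mono_mul (ts ! index_pos k) (ss ! index_pos l)) = CARD('m)"
    using clifford_table_wf(2)[OF tab, of k] by (simp add: mono_mul_def mono_wf_def)
  ultimately show "h (family ts (?\<pi> k) ** family ss (?\<pi> l)) =
      (snd (ps ! index_pos k) * snd (ps ! index_pos l)) *\<^sub>R (family ts k ** family ss l)"
    unfolding family_mult[OF tab] using eq
    by (simp add: table_equivariant_def H ps' monomial_scaleR)
qed

section \<open>The tables of the standard involutions\<close>

definition sign_table :: "nat \<Rightarrow> nat set \<Rightarrow> (nat \<times> 'a::comm_ring_1) list" where
  "sign_table n S = map (\<lambda>r. (r, if r \<in> S then 1 else - 1)) [0..<n]"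

definition diag_table :: "nat \<Rightarrow> nat \<Rightarrow> (nat \<times> 'a::comm_ring_1) list" where
  "diag_table a b = sign_table (a + b) {..<a}"

definition J_table :: "nat \<Rightarrow> (nat \<times> 'a::comm_ring_1) list" where
  "J_table n = map (\<lambda>r. if r < n then (r + n, - 1) else (r - n, 1)) [0..<2 * n]"

lemma diag_sign_monomial:
  assumes "CARD('n) = a + b"
  shows "(diag_sign a b :: ('a::comm_ring_1, 'n::{finite,linorder}) sqmat) = monomial (diag_table a b)"
proof -
  have "index_pos i < a + b" for i :: 'n
    using index_pos_less[of i] assms by simp
  then show ?thesis
    by (auto simp: vec_eq_iff diag_sign_def monomial_def diag_table_def sign_table_def)
qed

lemma J_mat_monomial:
  assumes "CARD('n) = 2 * n"
  shows "(J_mat n :: ('a::comm_ring_1, 'n::{finite,linorder}) sqmat) = monomial (J_table n)"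
proof -
  have bound: "index_pos i < 2 * n" for i :: 'n
    using index_pos_less[of i] assms by simp
  moreover have "index_pos j \<noteq> index_pos i + n" if "\<not> index_pos i < n" for i j :: 'n
    using bound[of j] that by linarith
  moreover have "n > 0"
    using assms zero_less_card_finite[where 'a = 'n] by linarith
  ultimately show ?thesis
    by (auto simp: vec_eq_iff J_mat_def monomial_def J_table_def)
qed

lemma mono_sqrt_sign_table:
  "mono_sqrt n 1 (sign_table n S :: (nat \<times> 'a::{comm_ring_1,real_algebra_1}) list)"
  by (simp add: mono_sqrt_def mono_invol_def sign_table_def)

lemma mono_sqrt_diag_table:
  "n = a + b \<Longrightarrow> mono_sqrt n 1 (diag_table a b :: (nat \<times> 'a::{comm_ring_1,real_algebra_1}) list)"
  by (simp add: diag_table_def mono_sqrt_sign_table)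

lemma mono_sqrt_J_table:
  "m = 2 * n \<Longrightarrow> mono_sqrt m (- 1) (J_table n :: (nat \<times> 'a::{comm_ring_1,real_algebra_1}) list)"
  by (auto simp: mono_sqrt_def mono_invol_def J_table_def)

lemma J_conjugation_monomial:
  assumes "CARD('n) = 2 * n" "mono_wf CARD('n) xs"
  shows "J_conjugation n (monomial xs :: (complex, 'n::{finite,linorder}) sqmat) =
    monomial (mono_conj (- 1) (J_table n) (mono_map cnj xs))"
  using assms mono_sqrt_J_table[OF assms(1), where 'a = complex]
  by (simp add: J_conjugation_def J_mat_monomial monomial_cnj mono_wf_def)
    (simp add: conj_by_monomial mono_wf_def mono_map_def list_all_length)

lemma linear_J_conjugation:
  assumes "CARD('n) = 2 * n"
  shows "linear (J_conjugation n :: (complex, 'n::{finite,linorder}) sqmat \<Rightarrow> (complex, 'n) sqmat)"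
proof -
  have "J_conjugation n = conj_by (J_mat n) \<circ> (map_matrix cnj :: (complex, 'n) sqmat \<Rightarrow> (complex, 'n) sqmat)"
    by (simp add: fun_eq_iff J_conjugation_def)
  then show ?thesis
    unfolding J_mat_monomial[OF assms]
    using linear_compose[OF linear_map_cnj linear_conj_by_monomial[OF mono_sqrt_J_table[OF assms]]] by simp
qed

lemma J_table_not_scalar: "0 < n \<Longrightarrow> \<not> mono_scalar (J_table n :: (nat \<times> real) list)"
  unfolding mono_scalar_def
proof (rule notI, elim exE)
  fix c assume "0 < n" and scalar: "\<forall>r<length (J_table n). J_table n ! r = (r, c :: real)"
  then show False
    using scalar[rule_format, of 0] by (simp add: J_table_def)
qed

lemma so_sign_involution:
  assumes "n = CARD('n::{finite,linorder})" "3 \<le> n" "p \<in> S" "p < n" "q \<notin> S" "q < n"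
  shows "lie_involution (so_alg TYPE('n)) (conj_by (monomial (sign_table n S)))"
proof (rule so_involution_monomial[where \<epsilon> = 1])
  show "\<not> mono_scalar (sign_table n S :: (nat \<times> real) list)"
  proof
    assume "mono_scalar (sign_table n S :: (nat \<times> real) list)"
    then obtain c where "\<And>r. r < n \<Longrightarrow> sign_table n S ! r = (r, c :: real)"
      by (auto simp: mono_scalar_def sign_table_def)
    from this[of p] this[of q] show False
      using assms by (simp add: sign_table_def)
  qed
qed (use assms in \<open>simp_all add: mono_sqrt_sign_table\<close>)

lemma so_fix_so_so_involution:
  assumes "CARD('n::{finite,linorder}) = a + b" "3 \<le> a + b" "0 < a" "0 < b"
  shows "lie_involution (so_alg TYPE('n)) (so_fix_so_so a b)"
  using so_sign_involution[of "a + b" 0 "{..<a}" a, where 'n = 'n] assms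
  by (simp add: so_fix_so_so_def diag_sign_monomial diag_table_def)

lemma so_fix_u_involution:
  assumes "CARD('n::{finite,linorder}) = 2 * n" "2 \<le> n"
  shows "lie_involution (so_alg TYPE('n)) (so_fix_u n)"
  using so_involution_monomial[OF _ mono_sqrt_J_table[OF assms(1)] J_table_not_scalar] assms
  by (simp add: so_fix_u_def J_mat_monomial)

lemma so_conj_by_skew_inner:
  fixes ps :: "(nat \<times> real) list"
  assumes ps: "mono_sqrt CARD('n::{finite,linorder}) (- 1) ps"
  shows "conj_by (monomial ps) \<in> Int_group (so_alg TYPE('n))" "lie_aut (so_alg TYPE('n)) (conj_by (monomial ps))"
    "conj_by (monomial ps) (conj_by (monomial ps) Y) = (Y :: (real, 'n) sqmat)"
proof -
  show "conj_by (monomial ps) \<in> Int_group (so_alg TYPE('n))"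
    using mono_sqrt_square[OF ps] mono_sqrt_transpose[OF ps] subspace_so
    by (intro conj_by_inner) (simp_all add: so_alg_def)
  show "lie_aut (so_alg TYPE('n)) (conj_by (monomial ps))"
    using so_conj_by_aut[OF mono_sqrt_square[OF ps] _ mono_sqrt_transpose[OF ps]] by simp
  show "conj_by (monomial ps) (conj_by (monomial ps) Y) = Y"
    using conj_by_sqrt_hom(2)[OF mono_sqrt_square[OF ps]] by simp
qed

text \<open>The hypotheses on the tables say that the signed permutation \<open>X\<close> exchanges the coordinates in \<open>S\<close>
  and the first \<open>a\<close> coordinates.\<close>

lemma so_fix_so_so_intertwine:
  fixes Y :: "(real, 'n::{finite,linorder}) sqmat"
  assumes n: "n = CARD('n)" "n = a + b" and X: "mono_sqrt n (- 1) X"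
    and tables: "mono_mul (diag_table a b) X = mono_mul X (sign_table n S)"
      "mono_mul X (diag_table a b) = mono_mul (sign_table n S) X"
  shows "so_fix_so_so a b (conj_by (monomial X) Y) =
    conj_by (monomial X) (conj_by (monomial (sign_table n S)) Y)"
proof -
  let ?D = "diag_table a b :: (nat \<times> real) list" and ?S = "sign_table n S :: (nat \<times> real) list"
  have sqrt: "mono_sqrt CARD('n) 1 ?D" "mono_sqrt CARD('n) 1 ?S" "mono_sqrt CARD('n) (- 1) X"
    using n X by (simp_all add: mono_sqrt_diag_table mono_sqrt_sign_table)
  then have wf: "mono_wf CARD('n) ?D" "mono_wf CARD('n) ?S" "mono_wf CARD('n) X"
    by (simp_all add: mono_sqrt_def mono_invol_wf)
  moreover have "length ?D = CARD('n)" "length ?S = CARD('n)" "length X = CARD('n)"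
    using wf by (simp_all add: mono_wf_def)
  ultimately show ?thesis
    unfolding so_fix_so_so_def diag_sign_monomial[OF n(2)[unfolded n(1)]]
    using sqrt[THEN mono_sqrt_square] tables
    by (intro conj_by_intertwine[where \<epsilon> = 1 and \<delta> = "- 1"]) (simp_all add: monomial_mult)
qed

section \<open>Quaternion units and the isomorphism of \<open>\<ss>\<oo>(6)\<close> with \<open>\<ss>\<uu>(4)\<close>\<close>

text \<open>The \<open>2 \<times> 2\<close> matrices \<open>1\<close>, \<open>((0, - 1), (1, 0))\<close>, \<open>diag (1, - 1)\<close> and \<open>((0, 1), (1, 0))\<close>; their
  Kronecker products give two commuting copies \<open>I\<^sub>a\<close> and \<open>K\<^sub>a\<close> of the quaternion units among the skew
  \<open>4 \<times> 4\<close> matrices.  The numbering is such that \<open>I\<^sub>1 = J\<^sub>2\<close>, that \<open>I\<^sub>3\<close> and \<open>K\<^sub>3\<close> are block-diagonal,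
  and that conjugation by \<open>diag (1, - 1, - 1, - 1)\<close> exchanges \<open>I\<^sub>a\<close> and \<open>- K\<^sub>a\<close>.\<close>

definition one2 :: "(nat \<times> 'a::ring_1) list" where "one2 = [(0, 1), (1, 1)]"

definition eps2 :: "(nat \<times> 'a::ring_1) list" where "eps2 = [(1, - 1), (0, 1)]"

definition diag2 :: "(nat \<times> 'a::ring_1) list" where "diag2 = [(0, 1), (1, - 1)]"

definition swap2 :: "(nat \<times> 'a::ring_1) list" where "swap2 = [(1, 1), (0, 1)]"

definition kron :: "(nat \<times> 'a::ring_1) list \<Rightarrow> (nat \<times> 'a) list \<Rightarrow> (nat \<times> 'a) list" where
  "kron xs ys = concat (map (\<lambda>x. map (\<lambda>y. (fst x * length ys + fst y, snd x * snd y)) ys) xs)"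

definition quat_left :: "(nat \<times> 'a::ring_1) list list" where
  "quat_left = [kron eps2 one2, kron swap2 eps2, kron diag2 eps2]"

definition quat_right :: "(nat \<times> 'a::ring_1) list list" where
  "quat_right = [kron eps2 diag2, kron eps2 swap2, kron one2 eps2]"

lemmas quat_eval = quat_left_def quat_right_def kron_def one2_def eps2_def diag2_def swap2_def

lemma all_less:
  "(\<forall>i<4. P i) \<longleftrightarrow> P 0 \<and> P 1 \<and> P 2 \<and> P (3 :: nat)"
  "(\<forall>i<5. P i) \<longleftrightarrow> P 0 \<and> P 1 \<and> P 2 \<and> P 3 \<and> P (4 :: nat)"
  "(\<forall>i<6. P i) \<longleftrightarrow> P 0 \<and> P 1 \<and> P 2 \<and> P 3 \<and> P 4 \<and> P (5 :: nat)"
  "(\<forall>i<8. P i) \<longleftrightarrow> P 0 \<and> P 1 \<and> P 2 \<and> P 3 \<and> P 4 \<and> P 5 \<and> P 6 \<and> P (7 :: nat)"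
  by (auto simp: numeral_eq_Suc All_less_Suc)

lemma mono_one_eval: "mono_one 4 = [(0, 1), (1, 1), (2, 1), (3, 1)]"
  "mono_one 8 = [(0, 1), (1, 1), (2, 1), (3, 1), (4, 1), (5, 1), (6, 1), (7, 1)]"
  by (simp_all add: mono_one_def upt_rec numeral_eq_Suc)

lemma upt_eval: "[0..<4] = [0, 1, 2, 3]" "[0..<5] = [0, 1, 2, 3, 4]" "[0..<6] = [0, 1, 2, 3, 4, 5]"
  "[0..<8] = [0, 1, 2, 3, 4, 5, 6, 7]"
  by (simp_all add: upt_rec numeral_eq_Suc)

lemma sum_lessThan_4: "(\<Sum>r<4. f r) = f 0 + f 1 + f 2 + f (3 :: nat)"
  by (simp add: numeral_eq_Suc)

lemmas table_eval = mono_mul_def mono_map_def mono_conj_def J_table_def diag_table_def sign_table_def upt_eval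

text \<open>The \<open>I\<^sub>a\<close> are skew-hermitian and \<open>- \<i> K\<^sub>a\<close> is hermitian, so that the mixed Clifford relations reduce
  to \<open>I\<^sub>a K\<^sub>b = K\<^sub>b I\<^sub>a\<close>.  The sign of \<open>- \<i>\<close> makes conjugation by \<open>diag (1, - 1, - 1, - 1)\<close> correspond to
  \<open>J\<^sub>3\<close> and not to \<open>- J\<^sub>3\<close>.\<close>

definition spin6 :: "(nat \<times> complex) list list" where
  "spin6 = quat_left @ map (mono_map (\<lambda>a. - \<i> * a)) quat_right"

definition spin6' :: "(nat \<times> complex) list list" where
  "spin6' = map (\<lambda>xs. mono_transpose (mono_map cnj xs)) spin6"

lemma spin6_eval:
  "spin6 = [[(2, - 1), (3, - 1), (0, 1), (1, 1)], [(3, - 1), (2, 1), (1, - 1), (0, 1)],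
     [(1, - 1), (0, 1), (3, 1), (2, - 1)], [(2, \<i>), (3, - \<i>), (0, - \<i>), (1, \<i>)],
     [(3, \<i>), (2, \<i>), (1, - \<i>), (0, - \<i>)], [(1, \<i>), (0, - \<i>), (3, \<i>), (2, - \<i>)]]"
  by (simp add: spin6_def quat_eval mono_map_def numeral_eq_Suc)

lemma spin6'_eval:
  "spin6' = [[(2, 1), (3, 1), (0, - 1), (1, - 1)], [(3, 1), (2, - 1), (1, 1), (0, - 1)],
     [(1, 1), (0, - 1), (3, - 1), (2, 1)], [(2, \<i>), (3, - \<i>), (0, - \<i>), (1, \<i>)],
     [(3, \<i>), (2, \<i>), (1, - \<i>), (0, - \<i>)], [(1, \<i>), (0, - \<i>), (3, \<i>), (2, - \<i>)]]"
  by (simp add: spin6'_def spin6_eval mono_map_def mono_transpose_def numeral_eq_Suc)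

lemma clifford_spin6: "clifford_table 6 4 spin6 spin6'"
  unfolding clifford_table_def all_less
  by (simp add: spin6_eval spin6'_eval mono_wf_def mono_mul_def mono_map_def mono_one_eval)

abbreviation \<Psi>\<^sub>6 :: "real^6^6 \<Rightarrow> complex^4^4" where
  "\<Psi>\<^sub>6 \<equiv> spin_map (family spin6) (family spin6')"

text \<open>Complex conjugation fixes \<open>I\<^sub>a\<close> and negates \<open>- \<i> K\<^sub>a\<close>.\<close>

lemma spin6_so: "su_fix_so (\<Psi>\<^sub>6 A) = \<Psi>\<^sub>6 (so_fix_so_so 3 3 A)"
proof -
  have "map_matrix cnj (\<Psi>\<^sub>6 A) = \<Psi>\<^sub>6 (conj_by (monomial (diag_table 3 3)) A)"
  proof (rule spin_map_equivariant_table[where \<epsilon> = 1 and H = "mono_map cnj"])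
    show "table_equivariant CARD(6) (mono_map cnj) (diag_table 3 3) spin6 spin6'"
      by (simp add: table_equivariant_def all_less) (simp add: spin6_eval spin6'_eval table_eval)
  qed (simp_all add: clifford_spin6 linear_map_cnj mono_sqrt_diag_table monomial_cnj mono_wf_def)
  then show ?thesis
    by (simp add: su_fix_so_def so_fix_so_so_def diag_sign_monomial)
qed

text \<open>With \<open>J = I\<^sub>1\<close> one has \<open>J s J = \<plusminus> cnj s\<close> for every \<open>s\<close> in the family, and the sign is negative for
  \<open>s = I\<^sub>1\<close> alone.\<close>

lemma spin6_sp: "su_fix_sp 2 (\<Psi>\<^sub>6 A) = \<Psi>\<^sub>6 (so_fix_so_so 1 5 A)"
proof -
  have "J_conjugation 2 (\<Psi>\<^sub>6 A) = \<Psi>\<^sub>6 (conj_by (monomial (diag_table 1 5)) A)"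
  proof (rule spin_map_equivariant_table[where \<epsilon> = 1 and H = "\<lambda>xs. mono_conj (- 1) (J_table 2) (mono_map cnj xs)"])
    show "table_equivariant CARD(6) (\<lambda>xs. mono_conj (- 1) (J_table 2) (mono_map cnj xs)) (diag_table 1 5) spin6 spin6'"
      by (simp add: table_equivariant_def all_less) (simp add: spin6_eval spin6'_eval table_eval)
  qed (simp_all add: clifford_spin6 linear_J_conjugation J_conjugation_monomial mono_sqrt_diag_table)
  then show ?thesis
    by (simp add: su_fix_sp_def so_fix_so_so_def diag_sign_monomial)
qed

text \<open>Of the six matrices, only the block-diagonal ones \<open>I\<^sub>3\<close> and \<open>- \<i> K\<^sub>3\<close> commute with
  \<open>diag (1, 1, - 1, - 1)\<close>; the others anticommute with it.\<close>

lemma spin6_s_u2_u2: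
  "su_fix_s_u_u 2 2 (\<Psi>\<^sub>6 A) = \<Psi>\<^sub>6 (conj_by (monomial (sign_table 6 {2, 5})) A)"
proof -
  have "conj_by (monomial (diag_table 2 2)) (\<Psi>\<^sub>6 A) = \<Psi>\<^sub>6 (conj_by (monomial (sign_table 6 {2, 5})) A)"
  proof (rule spin_map_equivariant_table[where \<epsilon> = 1 and H = "mono_conj 1 (diag_table 2 2)"])
    show "table_equivariant CARD(6) (mono_conj 1 (diag_table 2 2)) (sign_table 6 {2, 5}) spin6 spin6'"
      by (simp add: table_equivariant_def all_less) (simp add: spin6_eval spin6'_eval table_eval)
  qed (simp_all add: clifford_spin6 mono_sqrt_sign_table linear_conj_by_monomial[where \<epsilon> = 1]
      conj_by_monomial[where \<epsilon> = 1]
      mono_sqrt_diag_table)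
  then show ?thesis
    by (simp add: su_fix_s_u_u_def diag_sign_monomial)
qed

text \<open>Conjugation by \<open>diag (1, - 1, - 1, - 1)\<close> maps \<open>I\<^sub>a\<close> to \<open>- \<i> (- \<i> K\<^sub>a)\<close> and \<open>- \<i> K\<^sub>a\<close> to \<open>\<i> I\<^sub>a\<close>; on the
  adjoints \<open>t\<^sub>i\<close> the factors \<open>- \<i>\<close> and \<open>\<i>\<close> are exchanged, so that they cancel in \<open>t\<^sub>i s\<^sub>j\<close>.\<close>

lemma spin6_s_u1_u3: "su_fix_s_u_u 1 3 (\<Psi>\<^sub>6 A) = \<Psi>\<^sub>6 (so_fix_u 3 A)"
proof -
  have "conj_by (monomial (diag_table 1 3)) (\<Psi>\<^sub>6 A) = \<Psi>\<^sub>6 (conj_by (monomial (J_table 3)) A)"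
  proof (rule spin_map_equivariant_table[where \<epsilon> = "- 1" and H = "mono_conj 1 (diag_table 1 3)"])
    show "table_equivariant CARD(6) (mono_conj 1 (diag_table 1 3)) (J_table 3) spin6 spin6'"
      by (simp add: table_equivariant_def all_less) (simp add: spin6_eval spin6'_eval table_eval)
  qed (simp_all add: clifford_spin6 linear_conj_by_monomial[where \<epsilon> = 1]
      conj_by_monomial[where \<epsilon> = 1]
      mono_sqrt_diag_table mono_sqrt_J_table)
  then show ?thesis
    by (simp add: su_fix_s_u_u_def so_fix_u_def diag_sign_monomial J_mat_monomial)
qed

lemma length_spin6: "length spin6 = 6"
  by (simp add: spin6_eval)

lemma family_spin6'_adjoint: "family spin6' i = adjoint_mat (family spin6 i :: complex^4^4)" for i :: 6
proof -
  have "\<forall>k<6. mono_invol 4 (spin6 ! k)"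
    unfolding mono_invol_def all_less by (simp add: spin6_eval)
  then have "mono_invol CARD(4) (spin6 ! index_pos i)"
    using index_pos_less[of i] by simp
  moreover have "spin6' ! index_pos i = mono_transpose (mono_map cnj (spin6 ! index_pos i))"
    using index_pos_less[of i] by (simp add: spin6'_def length_spin6)
  ultimately show ?thesis
    by (simp add: family_def adjoint_monomial)
qed

lemma clifford_family_spin6: "clifford_family (family spin6 :: 6 \<Rightarrow> complex^4^4) (family spin6')"
  by (rule clifford_family_table) (simp add: clifford_spin6)

lemma spin6_prod_in_su:
  fixes i j :: 6
  assumes "i \<noteq> j"
  shows "family spin6' i ** family spin6 j \<in> carrier (su_alg TYPE(4))"
proof -
  have tr: "\<forall>k<6. \<forall>l<6. k \<noteq> l \<longrightarrow> (\<Sum>r<4. if fst (mono_mul (spin6' ! k) (spin6 ! l) ! r) = r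
      then snd (mono_mul (spin6' ! k) (spin6 ! l) ! r) else 0) = 0"
    unfolding all_less sum_lessThan_4 by (simp add: spin6_eval spin6'_eval table_eval)
  have "trace (family spin6' i ** family spin6 j :: complex^4^4) = 0"
    using tr[rule_format, of "index_pos i" "index_pos j"] index_pos_less[of i] index_pos_less[of j] assms
    by (subst family_mult) (simp_all add: clifford_spin6 trace_monomial)
  moreover have "adjoint_mat (family spin6' i ** family spin6 j) =
      (family spin6' j ** family spin6 i :: complex^4^4)"
    by (simp add: adjoint_mat_mult family_spin6'_adjoint)
  moreover have "family spin6' j ** family spin6 i = - (family spin6' i ** family spin6 j :: complex^4^4)"
    using clifford_family.ts[OF clifford_family_spin6, of i j] assms by (simp add: add_eq_0_iff)
  ultimately show ?thesis
    by (simp add: su_carrier)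
qed

text \<open>Each product \<open>t\<^sub>i s\<^sub>j\<close> is supported on one of four disjoint permutation patterns.  The three or four
  equations that belong to a pattern, with skewness and the vanishing trace, make the entries of
  \<open>M\<close> there vanish.\<close>

lemma su4_orthogonal:
  fixes M :: "complex^4^4"
  assumes M: "M \<in> carrier (su_alg TYPE(4))"
    and orth: "\<And>i j :: 6. i \<noteq> j \<Longrightarrow> (family spin6' i ** family spin6 j) \<bullet> M = 0"
  shows "M = 0"
proof -
  define m where "m r c = M $ index_at r $ index_at c" for r c
  have "\<forall>k<6. \<forall>l<6. k < l \<longrightarrow>
      (\<Sum>r<4. snd (mono_mul (spin6' ! k) (spin6 ! l) ! r) \<bullet>
        m r (fst (mono_mul (spin6' ! k) (spin6 ! l) ! r))) = 0"
  proof (intro allI impI)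
    fix k l :: nat assume kl: "k < 6" "l < 6" "k < l"
    then have ne: "index_pos (index_at k :: 6) \<noteq> index_pos (index_at l :: 6)"
      by simp
    then have ne: "(index_at k :: 6) \<noteq> index_at l"
      by metis
    have wf: "mono_wf CARD(4) (mono_mul (spin6' ! k) (spin6 ! l))"
      using clifford_spin6 kl by (intro mono_wf_mul) (simp_all add: clifford_table_def list_all_length)
    have "monomial (mono_mul (spin6' ! k) (spin6 ! l)) \<bullet> M = 0"
      using orth[of "index_at k" "index_at l"] ne kl by (simp add: family_mult clifford_spin6)
    then show "(\<Sum>r<4. snd (mono_mul (spin6' ! k) (spin6 ! l) ! r) \<bullet>
        m r (fst (mono_mul (spin6' ! k) (spin6 ! l) ! r))) = 0"
      by (simp add: inner_monomial[OF wf] m_def)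
  qed
  then have "(Re (m 1 0) - Re (m 0 1) + Re (m 2 3) = Re (m 3 2)) \<and>
      (Re (m 0 3) - Re (m 1 2) + Re (m 2 1) = Re (m 3 0)) \<and>
      (Im (m 1 1) - Im (m 0 0) - Im (m 2 2) + Im (m 3 3) = 0) \<and>
      (- Im (m 0 1) - Im (m 1 0) - Im (m 2 3) = Im (m 3 2)) \<and>
      (Im (m 0 3) - Im (m 1 2) - Im (m 2 1) + Im (m 3 0) = 0) \<and>
      (- Re (m 0 2) - Re (m 1 3) + Re (m 2 0) + Re (m 3 1) = 0) \<and>
      (Im (m 0 1) + Im (m 1 0) - Im (m 2 3) = Im (m 3 2)) \<and>
      (Im (m 1 1) - Im (m 0 0) + Im (m 2 2) = Im (m 3 3)) \<and>
      (- Im (m 0 2) - Im (m 1 3) - Im (m 2 0) = Im (m 3 1)) \<and>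
      (- Im (m 0 3) - Im (m 1 2) - Im (m 2 1) = Im (m 3 0)) \<and>
      (Im (m 0 2) - Im (m 1 3) + Im (m 2 0) = Im (m 3 1)) \<and>
      (- Im (m 0 0) - Im (m 1 1) + Im (m 2 2) + Im (m 3 3) = 0) \<and>
      (Re (m 0 1) - Re (m 1 0) + Re (m 2 3) = Re (m 3 2)) \<and>
      (- Re (m 0 3) - Re (m 1 2) + Re (m 2 1) + Re (m 3 0) = 0) \<and>
      (Re (m 0 2) - Re (m 1 3) - Re (m 2 0) + Re (m 3 1) = 0)"
    unfolding all_less sum_lessThan_4
    by (simp add: spin6_eval spin6'_eval table_eval inner_complex_def)
  then have eqs: "Re (m 1 0) - Re (m 0 1) + Re (m 2 3) = Re (m 3 2)"
      "Re (m 0 3) - Re (m 1 2) + Re (m 2 1) = Re (m 3 0)"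
      "Im (m 1 1) - Im (m 0 0) - Im (m 2 2) + Im (m 3 3) = 0"
      "- Im (m 0 1) - Im (m 1 0) - Im (m 2 3) = Im (m 3 2)"
      "Im (m 0 3) - Im (m 1 2) - Im (m 2 1) + Im (m 3 0) = 0"
      "- Re (m 0 2) - Re (m 1 3) + Re (m 2 0) + Re (m 3 1) = 0"
      "Im (m 0 1) + Im (m 1 0) - Im (m 2 3) = Im (m 3 2)"
      "Im (m 1 1) - Im (m 0 0) + Im (m 2 2) = Im (m 3 3)"
      "- Im (m 0 2) - Im (m 1 3) - Im (m 2 0) = Im (m 3 1)"
      "- Im (m 0 3) - Im (m 1 2) - Im (m 2 1) = Im (m 3 0)"
      "Im (m 0 2) - Im (m 1 3) + Im (m 2 0) = Im (m 3 1)"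
      "- Im (m 0 0) - Im (m 1 1) + Im (m 2 2) + Im (m 3 3) = 0"
      "Re (m 0 1) - Re (m 1 0) + Re (m 2 3) = Re (m 3 2)"
      "- Re (m 0 3) - Re (m 1 2) + Re (m 2 1) + Re (m 3 0) = 0"
      "Re (m 0 2) - Re (m 1 3) - Re (m 2 0) + Re (m 3 1) = 0"
    by blast+
  have skew: "Re (m c r) = - Re (m r c)" "Im (m c r) = Im (m r c)" for r c
  proof -
    have "adjoint_mat M $ index_at r $ index_at c = (- M) $ index_at r $ index_at c"
      using M by (simp add: su_carrier)
    then have "cnj (m c r) = - m r c"
      by (simp add: adjoint_mat_entry m_def)
    then show "Re (m c r) = - Re (m r c)" "Im (m c r) = Im (m r c)"
      by (simp_all add: complex_eq_iff)
  qed
  have "(\<Sum>r<4. m r r) = 0"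
    using M by (simp add: su_carrier trace_def sum_index_pos m_def)
  then have tr: "Im (m 0 0) + Im (m 1 1) + Im (m 2 2) + Im (m 3 3) = 0"
    unfolding sum_lessThan_4 by (simp add: complex_eq_iff)
  have "Re (m 0 1) = 0" "Im (m 0 1) = 0" "Re (m 2 3) = 0" "Im (m 2 3) = 0"
    using eqs(1,4,7,13) skew[of 0 1] skew[of 2 3] by linarith+
  moreover have "Re (m 0 2) = 0" "Im (m 0 2) = 0" "Re (m 1 3) = 0" "Im (m 1 3) = 0"
    using eqs(6,9,11,15) skew[of 0 2] skew[of 1 3] by linarith+
  moreover have "Re (m 0 3) = 0" "Im (m 0 3) = 0" "Re (m 1 2) = 0" "Im (m 1 2) = 0"
    using eqs(2,5,10,14) skew[of 0 3] skew[of 1 2] by linarith+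
  moreover have "Im (m 0 0) = 0" "Im (m 1 1) = 0" "Im (m 2 2) = 0" "Im (m 3 3) = 0"
    using eqs(3,8,12) tr by linarith+
  moreover have "Re (m r r) = 0" for r
    using skew(1)[of r r] by simp
  ultimately have "\<forall>r<4. \<forall>c<4. m r c = 0"
    unfolding all_less complex_eq_iff
    using skew[of 0 1] skew[of 0 2] skew[of 0 3] skew[of 1 2] skew[of 1 3] skew[of 2 3] by simp
  then have "M $ a $ b = 0" for a b
    using m_def[of "index_pos a" "index_pos b"] index_pos_less[of a] index_pos_less[of b] by simp
  then show ?thesis
    by (simp add: vec_eq_iff)
qed

text \<open>Up to a factor the products \<open>t\<^sub>i s\<^sub>j\<close> with \<open>i \<noteq> j\<close> are the images of the elementary skew matrices, so
  that an element of \<open>\<ss>\<uu>(4)\<close> orthogonal to the image vanishes.\<close>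

lemma spin6_image: "\<Psi>\<^sub>6 ` carrier (so_alg TYPE(6)) = carrier (su_alg TYPE(4))"
proof (rule ccontr)
  let ?V = "\<Psi>\<^sub>6 ` carrier (so_alg TYPE(6))" and ?W = "carrier (su_alg TYPE(4))"
  assume neq: "?V \<noteq> ?W"
  have "?V \<subseteq> ?W"
    using spin_map_in_subspace[where s = "family spin6" and t = "family spin6'", OF subspace_su spin6_prod_in_su]
    by blast
  then have "?V \<subset> ?W"
    using neq by blast
  moreover have V: "subspace ?V"
    using linear_subspace_image[OF linear_spin_map subspace_so] by (simp add: so_alg_def)
  ultimately have "span ?V \<subset> span ?W"
    using V subspace_su[of "TYPE(4)"] by (simp only: span_eq_iff[THEN iffD2])
  from orthogonal_to_subspace_exists_gen[OF this] obtain M where "M \<noteq> 0" "M \<in> span ?W"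
    and M: "\<And>y. y \<in> span ?V \<Longrightarrow> orthogonal M y"
    by blast
  then have "M \<noteq> 0" "M \<in> ?W"
    using span_eq_iff[THEN iffD2, OF subspace_su[of "TYPE(4)"]] by simp_all
  have "(family spin6' i ** family spin6 j) \<bullet> M = 0" if "i \<noteq> j" for i j :: 6
    using M[OF span_base[OF imageI[OF so_elem_in_so[of i j]]]] that
    by (simp add: spin_map_so_elem clifford_family_spin6 orthogonal_def inner_commute)
  then show False
    using su4_orthogonal[of M] \<open>M \<noteq> 0\<close> \<open>M \<in> ?W\<close> by blast
qed

lemma spin6_iso: "lie_iso (so_alg TYPE(6)) (su_alg TYPE(4)) \<Psi>\<^sub>6"
  by (subst su_alg_eq, rule clifford_family.spin_map_lie_iso[OF clifford_family_spin6 _ spin6_image]) simp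

lemma su4_compact_semisimple: "compact_semisimple (su_alg TYPE(4))"
proof (subst su_alg_eq, rule compact_semisimple_if_iso_so)
  show "lie_iso (so_alg TYPE(6)) \<lparr>carrier = carrier (su_alg TYPE(4)), bracket = commutator\<rparr> \<Psi>\<^sub>6"
    using spin6_iso su_alg_eq by metis
qed (simp_all add: subspace_su commutator_in_su)

section \<open>The triads on \<open>\<ss>\<uu>(4)\<close> and \<open>\<ss>\<oo>(6)\<close>\<close>

text \<open>Counting from \<open>0\<close>, \<open>X6\<close> exchanges the coordinates \<open>0 \<leftrightarrow> 2\<close>, \<open>1 \<leftrightarrow> 5\<close> and \<open>3 \<leftrightarrow> 4\<close>, hence the sets
  \<open>{0, 1}\<close> and \<open>{2, 5}\<close>.  Each pair gets one negative sign, which makes the square \<open>- 1\<close>.\<close>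

definition X6 :: "(nat \<times> real) list" where
  "X6 = [(2, - 1), (5, - 1), (0, 1), (4, - 1), (3, 1), (1, 1)]"

lemma mono_sqrt_X6: "mono_sqrt 6 (- 1) X6"
  unfolding mono_sqrt_def mono_invol_def all_less by (simp add: X6_def)

lemma X6_intertwine: "so_fix_so_so 2 4 (conj_by (monomial X6) Y) =
    conj_by (monomial X6) (conj_by (monomial (sign_table 6 {2, 5})) (Y :: real^6^6))"
  by (rule so_fix_so_so_intertwine) (simp, simp, rule mono_sqrt_X6, simp_all add: X6_def table_eval)

lemma so6_compact_semisimple: "compact_semisimple (so_alg TYPE(6))"
  by (rule so_compact_semisimple) simp

lemmas su4_so6_pullback = triad_equiv_pullback[OF spin6_iso su4_compact_semisimple so6_compact_semisimple]

lemma triad_su4_so_sp: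
  "(su_alg TYPE(4), su_fix_so, su_fix_sp 2) \<sim>\<^sub>t
   (so_alg TYPE(6), so_fix_so_so 3 3, so_fix_so_so 1 5)"
  by (rule su4_so6_pullback[where \<tau> = id and \<rho> = "so_fix_so_so 1 5"])
    (simp_all add: so_fix_so_so_involution id_inner so_lie_algebra spin6_so spin6_sp)

lemma triad_su4_so_s_u2_u2:
  "(su_alg TYPE(4), su_fix_so, su_fix_s_u_u 2 2) \<sim>\<^sub>t
   (so_alg TYPE(6), so_fix_so_so 3 3, so_fix_so_so 2 4)"
  by (rule su4_so6_pullback[where \<tau> = "conj_by (monomial X6)" and \<rho> = "conj_by (monomial (sign_table 6 {2, 5}))"])
    (simp_all add: so_fix_so_so_involution so_sign_involution[where p = 2 and q = 1]
      so_conj_by_skew_inner mono_sqrt_X6 spin6_so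
      spin6_s_u2_u2 X6_intertwine)

lemma triad_su4_so_s_u1_u3:
  "(su_alg TYPE(4), su_fix_so, su_fix_s_u_u 1 3) \<sim>\<^sub>t
   (so_alg TYPE(6), so_fix_so_so 3 3, so_fix_u 3)"
  by (rule su4_so6_pullback[where \<tau> = id and \<rho> = "so_fix_u 3"])
    (simp_all add: so_fix_so_so_involution so_fix_u_involution id_inner so_lie_algebra spin6_so
      spin6_s_u1_u3[unfolded One_nat_def])

lemma triad_su4_sp_s_u2_u2:
  "(su_alg TYPE(4), su_fix_sp 2, su_fix_s_u_u 2 2) \<sim>\<^sub>t
   (so_alg TYPE(6), so_fix_so_so 1 5, so_fix_so_so 2 4)"
  by (rule su4_so6_pullback[where \<tau> = "conj_by (monomial X6)" and \<rho> = "conj_by (monomial (sign_table 6 {2, 5}))"])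
    (simp_all add: so_fix_so_so_involution so_sign_involution[where p = 2 and q = 1]
      so_conj_by_skew_inner mono_sqrt_X6 spin6_sp
      spin6_s_u2_u2 X6_intertwine)

lemma triad_su4_sp_s_u1_u3:
  "(su_alg TYPE(4), su_fix_sp 2, su_fix_s_u_u 1 3) \<sim>\<^sub>t
   (so_alg TYPE(6), so_fix_so_so 1 5, so_fix_u 3)"
  by (rule su4_so6_pullback[where \<tau> = id and \<rho> = "so_fix_u 3"])
    (simp_all add: so_fix_so_so_involution so_fix_u_involution id_inner so_lie_algebra spin6_sp
      spin6_s_u1_u3[unfolded One_nat_def])

text \<open>Here the second involution corresponds to the standard one, and \<open>X6\<close> is needed for the first.\<close>

lemma triad_su4_s_u2_u2_s_u1_u3:
  "(su_alg TYPE(4), su_fix_s_u_u 2 2, su_fix_s_u_u 1 3) \<sim>\<^sub>t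
   (so_alg TYPE(6), so_fix_so_so 2 4, so_fix_u 3)"
  by (rule triad_equiv_pullback'[OF spin6_iso su4_compact_semisimple so6_compact_semisimple,
        where \<tau> = "conj_by (monomial X6)" and \<rho> = "conj_by (monomial (sign_table 6 {2, 5}))"])
    (simp_all add: so_fix_so_so_involution so_fix_u_involution so_sign_involution[where p = 2 and q = 1] so_conj_by_skew_inner
      mono_sqrt_X6 spin6_s_u2_u2 spin6_s_u1_u3[unfolded One_nat_def] X6_intertwine)

section \<open>Triality\<close>

text \<open>With \<open>\<epsilon> = ((0, - 1), (1, 0))\<close>, \<open>d = diag (1, - 1)\<close> and \<open>x = ((0, 1), (1, 0))\<close> the family is
  \<open>1\<close>, \<open>\<epsilon> \<otimes> 1\<close>, \<open>d \<otimes> I\<^sub>1\<close>, \<open>x \<otimes> K\<^sub>1\<close>, \<open>d \<otimes> I\<^sub>2\<close>, \<open>d \<otimes> I\<^sub>3\<close>, \<open>x \<otimes> K\<^sub>2\<close>, \<open>x \<otimes> K\<^sub>3\<close>: the identity and seven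
  anticommuting complex structures on \<open>\<real>\<^sup>8\<close>.  The first two are placed so that \<open>t\<^sub>1 s\<^sub>2 = J\<^sub>4\<close>.  The
  order of the others makes the sign pattern of \<open>diag (I\<^sub>4, - I\<^sub>4)\<close> share an even number of positive
  positions with the standard pattern, which permits a fixed-point-free involution between them.\<close>

definition spin8 :: "(nat \<times> real) list list" where
  "spin8 = [mono_one 8, kron eps2 (mono_one 4), kron diag2 (quat_left ! 0), kron swap2 (quat_right ! 0),
     kron diag2 (quat_left ! 1), kron diag2 (quat_left ! 2), kron swap2 (quat_right ! 1), kron swap2 (quat_right ! 2)]"

definition spin8' :: "(nat \<times> real) list list" where
  "spin8' = map mono_transpose spin8"

lemma spin8_eval:
  "spin8 = [[(0, 1), (1, 1), (2, 1), (3, 1), (4, 1), (5, 1), (6, 1), (7, 1)],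
     [(4, - 1), (5, - 1), (6, - 1), (7, - 1), (0, 1), (1, 1), (2, 1), (3, 1)],
     [(2, - 1), (3, - 1), (0, 1), (1, 1), (6, 1), (7, 1), (4, - 1), (5, - 1)],
     [(6, - 1), (7, 1), (4, 1), (5, - 1), (2, - 1), (3, 1), (0, 1), (1, - 1)],
     [(3, - 1), (2, 1), (1, - 1), (0, 1), (7, 1), (6, - 1), (5, 1), (4, - 1)],
     [(1, - 1), (0, 1), (3, 1), (2, - 1), (5, 1), (4, - 1), (7, - 1), (6, 1)],
     [(7, - 1), (6, - 1), (5, 1), (4, 1), (3, - 1), (2, - 1), (1, 1), (0, 1)],
     [(5, - 1), (4, 1), (7, - 1), (6, 1), (1, - 1), (0, 1), (3, - 1), (2, 1)]]"
  unfolding spin8_def mono_one_eval by (simp add: quat_eval numeral_eq_Suc)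

lemma spin8'_eval:
  "spin8' = [[(0, 1), (1, 1), (2, 1), (3, 1), (4, 1), (5, 1), (6, 1), (7, 1)],
     [(4, 1), (5, 1), (6, 1), (7, 1), (0, - 1), (1, - 1), (2, - 1), (3, - 1)],
     [(2, 1), (3, 1), (0, - 1), (1, - 1), (6, - 1), (7, - 1), (4, 1), (5, 1)],
     [(6, 1), (7, - 1), (4, - 1), (5, 1), (2, 1), (3, - 1), (0, - 1), (1, 1)],
     [(3, 1), (2, - 1), (1, 1), (0, - 1), (7, - 1), (6, 1), (5, - 1), (4, 1)],
     [(1, 1), (0, - 1), (3, - 1), (2, 1), (5, - 1), (4, 1), (7, 1), (6, - 1)],
     [(7, 1), (6, 1), (5, - 1), (4, - 1), (3, 1), (2, 1), (1, - 1), (0, - 1)],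
     [(5, 1), (4, - 1), (7, 1), (6, - 1), (1, 1), (0, - 1), (3, 1), (2, - 1)]]"
  by (simp add: spin8'_def spin8_eval mono_transpose_def)

lemma clifford_spin8: "clifford_table 8 8 spin8 spin8'"
  unfolding clifford_table_def all_less
  by (simp add: spin8_eval spin8'_eval mono_wf_def mono_mul_def mono_map_def mono_one_eval)

abbreviation \<Psi>\<^sub>8 :: "real^8^8 \<Rightarrow> real^8^8" where
  "\<Psi>\<^sub>8 \<equiv> spin_map (family spin8) (family spin8')"

lemma length_spin8: "length spin8 = 8"
  by (simp add: spin8_eval)

lemma family_spin8'_transpose: "family spin8' i = transpose (family spin8 i :: real^8^8)" for i :: 8
proof -
  have "\<forall>k<8. mono_invol 8 (spin8 ! k)"
    unfolding mono_invol_def all_less by (simp add: spin8_eval)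
  then have "mono_invol CARD(8) (spin8 ! index_pos i)"
    using index_pos_less[of i] by simp
  then show ?thesis
    using index_pos_less[of i]
    by (simp add: family_def monomial_transpose spin8'_def length_spin8)
qed

lemma clifford_family_spin8: "clifford_family (family spin8 :: 8 \<Rightarrow> real^8^8) (family spin8')"
  by (rule clifford_family_table) (simp add: clifford_spin8)

lemma spin8_prod_in_so:
  fixes i j :: 8
  assumes "i \<noteq> j"
  shows "family spin8' i ** family spin8 j \<in> carrier (so_alg TYPE(8))"
proof -
  have "transpose (family spin8' i ** family spin8 j) = (family spin8' j ** family spin8 i :: real^8^8)"
    by (simp add: matrix_transpose_mul family_spin8'_transpose)
  moreover have "family spin8' j ** family spin8 i = - (family spin8' i ** family spin8 j :: real^8^8)"
    using clifford_family.ts[OF clifford_family_spin8, of i j] assms by (simp add: add_eq_0_iff)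
  ultimately show ?thesis
    by (simp add: so_carrier)
qed

text \<open>An injective linear map of \<open>\<ss>\<oo>(8)\<close> to itself is surjective.\<close>

lemma spin8_image: "\<Psi>\<^sub>8 ` carrier (so_alg TYPE(8)) = carrier (so_alg TYPE(8))"
proof -
  let ?V = "carrier (so_alg TYPE(8))"
  have V: "subspace ?V"
    using subspace_so by (simp add: so_alg_def)
  have sub: "\<Psi>\<^sub>8 ` ?V \<subseteq> ?V"
    using spin_map_in_subspace[where s = "family spin8" and t = "family spin8'", OF V spin8_prod_in_so] by blast
  have "inj_on \<Psi>\<^sub>8 ?V"
    using clifford_family.spin_map_inj[OF clifford_family_spin8] by simp
  then have "dim (\<Psi>\<^sub>8 ` ?V) = dim ?V"
    using dim_image_eq[OF linear_spin_map, of "family spin8" "family spin8'" ?V] V by (simp add: span_eq_iff[THEN iffD2])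
  then show ?thesis
    using subspace_dim_equal[OF linear_subspace_image[OF linear_spin_map V] V sub] by simp
qed

lemma spin8_iso: "lie_iso (so_alg TYPE(8)) (so_alg TYPE(8)) \<Psi>\<^sub>8"
  by (subst (2) so_alg_eq, rule clifford_family.spin_map_lie_iso[OF clifford_family_spin8 _ spin8_image]) simp

text \<open>Conjugation by \<open>t\<^sub>1 s\<^sub>2 = J\<^sub>4\<close> changes the sign of the first two Clifford generators relative to the
  others.\<close>

lemma spin8_u: "so_fix_u 4 (\<Psi>\<^sub>8 A) = \<Psi>\<^sub>8 (so_fix_so_so 2 6 A)"
proof -
  have "conj_by (monomial (J_table 4)) (\<Psi>\<^sub>8 A) = \<Psi>\<^sub>8 (conj_by (monomial (diag_table 2 6)) A)"
  proof (rule spin_map_equivariant_table[where \<epsilon> = 1 and H = "mono_conj (- 1) (J_table 4)"])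
    show "table_equivariant CARD(8) (mono_conj (- 1) (J_table 4)) (diag_table 2 6) spin8 spin8'"
      by (simp add: table_equivariant_def all_less) (simp add: spin8_eval spin8'_eval table_eval)
  qed (simp_all add: clifford_spin8 linear_conj_by_monomial[where \<epsilon> = "- 1"]
      conj_by_monomial[where \<epsilon> = "- 1"]
      mono_sqrt_diag_table mono_sqrt_J_table)
  then show ?thesis
    by (simp add: so_fix_u_def so_fix_so_so_def diag_sign_monomial J_mat_monomial)
qed

text \<open>The matrix \<open>diag (I\<^sub>4, - I\<^sub>4) = d \<otimes> 1\<close> commutes with \<open>1\<close> and \<open>d \<otimes> I\<^sub>a\<close>, and it anticommutes with
  \<open>\<epsilon> \<otimes> 1\<close> and \<open>x \<otimes> K\<^sub>a\<close>.\<close>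

lemma spin8_so4_so4:
  "so_fix_so_so 4 4 (\<Psi>\<^sub>8 A) = \<Psi>\<^sub>8 (conj_by (monomial (sign_table 8 {0, 2, 4, 5})) A)"
proof -
  have "conj_by (monomial (diag_table 4 4)) (\<Psi>\<^sub>8 A) = \<Psi>\<^sub>8 (conj_by (monomial (sign_table 8 {0, 2, 4, 5})) A)"
  proof (rule spin_map_equivariant_table[where \<epsilon> = 1 and H = "mono_conj 1 (diag_table 4 4)"])
    show "table_equivariant CARD(8) (mono_conj 1 (diag_table 4 4)) (sign_table 8 {0, 2, 4, 5}) spin8 spin8'"
      by (simp add: table_equivariant_def all_less) (simp add: spin8_eval spin8'_eval table_eval)
  qed (simp_all add: clifford_spin8 linear_conj_by_monomial[where \<epsilon> = 1]
      conj_by_monomial[where \<epsilon> = 1]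
      mono_sqrt_diag_table mono_sqrt_sign_table)
  then show ?thesis
    by (simp add: so_fix_so_so_def diag_sign_monomial)
qed

text \<open>Counting from \<open>0\<close>, \<open>X8\<close> exchanges \<open>0 \<leftrightarrow> 2\<close>, \<open>1 \<leftrightarrow> 4\<close>, \<open>3 \<leftrightarrow> 5\<close> and \<open>6 \<leftrightarrow> 7\<close>, hence the sets
  \<open>{0, 1, 2, 3}\<close> and \<open>{0, 2, 4, 5}\<close>.\<close>

definition X8 :: "(nat \<times> real) list" where
  "X8 = [(2, - 1), (4, - 1), (0, 1), (5, - 1), (1, 1), (3, 1), (7, - 1), (6, 1)]"

lemma mono_sqrt_X8: "mono_sqrt 8 (- 1) X8"
  unfolding mono_sqrt_def mono_invol_def all_less by (simp add: X8_def)

lemma X8_intertwine: "so_fix_so_so 4 4 (conj_by (monomial X8) Y) =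
    conj_by (monomial X8) (conj_by (monomial (sign_table 8 {0, 2, 4, 5})) (Y :: real^8^8))"
  by (rule so_fix_so_so_intertwine) (simp, simp, rule mono_sqrt_X8, simp_all add: X8_def table_eval)

lemma triad_so8:
  "(so_alg TYPE(8), so_fix_u 4, so_fix_so_so 4 4) \<sim>\<^sub>t
   (so_alg TYPE(8), so_fix_so_so 2 6, so_fix_so_so 4 4)"
proof (rule triad_equiv_pullback[OF spin8_iso, where \<tau> = "conj_by (monomial X8)"
      and \<rho> = "conj_by (monomial (sign_table 8 {0, 2, 4, 5}))"])
  show "compact_semisimple (so_alg TYPE(8))"
    by (rule so_compact_semisimple) simp
  then show "compact_semisimple (so_alg TYPE(8))" .
qed (simp_all add: so_fix_so_so_involution so_sign_involution[where p = 2 and q = 1]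
    so_conj_by_skew_inner mono_sqrt_X8 spin8_u
    spin8_so4_so4 X8_intertwine)

section \<open>The symplectic Lie algebra\<close>

text \<open>The five matrices of the family \<open>spin6\<close> other than \<open>I\<^sub>1\<close> are taken in the order
  \<open>- \<i> K\<^sub>1\<close>, \<open>- \<i> K\<^sub>3\<close>, \<open>I\<^sub>2\<close>, \<open>I\<^sub>3\<close>, \<open>- \<i> K\<^sub>2\<close>.  The first one has to be \<open>- \<i> K\<^sub>1\<close>, the only one of the five
  that commutes with \<open>diag (1, - 1, 1, - 1)\<close>.  With \<open>- \<i> K\<^sub>3\<close> in the second place, the standard
  involution on \<open>\<ss>\<oo>(5)\<close> that singles out the first two coordinates corresponds to conjugation by
  \<open>K\<^sub>2\<close>.\<close>

definition iota :: "nat list" where "iota = [3, 5, 1, 2, 4]"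

definition spin5 :: "(nat \<times> complex) list list" where "spin5 = map ((!) spin6) iota"

definition spin5' :: "(nat \<times> complex) list list" where "spin5' = map ((!) spin6') iota"

lemma spin5_eval: "spin5 = [spin6 ! 3, spin6 ! 5, spin6 ! 1, spin6 ! 2, spin6 ! 4]"
  "spin5' = [spin6' ! 3, spin6' ! 5, spin6' ! 1, spin6' ! 2, spin6' ! 4]"
  by (simp_all add: spin5_def spin5'_def iota_def)

abbreviation \<Psi>\<^sub>5 :: "real^5^5 \<Rightarrow> complex^4^4" where
  "\<Psi>\<^sub>5 \<equiv> spin_map (family spin5) (family spin5')"

lemma clifford_spin5: "clifford_table 5 4 spin5 spin5'"
  unfolding clifford_table_def all_less spin5_eval
  by (simp add: spin6_eval spin6'_eval mono_wf_def mono_mul_def mono_map_def mono_one_eval)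

lemma clifford_family_spin5: "clifford_family (family spin5 :: 5 \<Rightarrow> complex^4^4) (family spin5')"
  by (rule clifford_family_table) (simp add: clifford_spin5)

definition embed5 :: "5 \<Rightarrow> 6" where "embed5 i = index_at (iota ! index_pos i)"

lemma iota_bounds: "k < 5 \<Longrightarrow> iota ! k < 6"
proof -
  have "\<forall>k<5. iota ! k < 6"
    unfolding all_less by (simp add: iota_def)
  then show "k < 5 \<Longrightarrow> iota ! k < 6" by blast
qed

lemma length_iota: "length iota = 5"
  by (simp add: iota_def)

lemma index_pos_embed5: "index_pos (embed5 i) = iota ! index_pos i"
  using index_pos_less[of i] iota_bounds by (simp add: embed5_def)

lemma family_spin5:
  "(family spin5 i :: complex^4^4) = family spin6 (embed5 i)"
  "(family spin5' i :: complex^4^4) = family spin6' (embed5 i)"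
  using index_pos_less[of i]
  by (simp_all add: family_def index_pos_embed5 spin5_def spin5'_def length_iota)

lemma sum_embed5:
  fixes f :: "6 \<Rightarrow> 'b::comm_monoid_add"
  assumes "f (index_at 0) = 0"
  shows "(\<Sum>i\<in>UNIV. f i) = (\<Sum>i\<in>UNIV. f (embed5 i))"
  unfolding sum_index_pos
  using assms by (simp add: embed5_def iota_def numeral_eq_Suc ac_simps)

lemma sp_carrier: "M \<in> carrier (sp_alg TYPE(2)) \<longleftrightarrow> M \<in> carrier (su_alg TYPE(4)) \<and> J_conjugation 2 M = M"
  by (simp add: sp_alg_def)

lemma sp_alg_eq: "sp_alg T = \<lparr>carrier = carrier (sp_alg T), bracket = commutator\<rparr>"
  by (simp add: sp_alg_def)

lemma subspace_sp: "subspace (carrier (sp_alg TYPE(2)))"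
proof -
  have lin: "linear (J_conjugation 2 :: complex^4^4 \<Rightarrow> complex^4^4)"
    by (rule linear_J_conjugation) simp
  have "subspace {M :: complex^4^4. J_conjugation 2 M = M}"
    by (simp add: subspace_def linear_0[OF lin] linear_add[OF lin] linear_scale[OF lin])
  moreover have "carrier (sp_alg TYPE(2)) = carrier (su_alg TYPE(4)) \<inter> {M. J_conjugation 2 M = M}"
    by (auto simp: sp_carrier)
  ultimately show ?thesis
    using subspace_inter[OF subspace_su] by simp
qed

lemma commutator_in_sp:
  assumes "x \<in> carrier (sp_alg TYPE(2))" "y \<in> carrier (sp_alg TYPE(2))"
  shows "commutator x y \<in> carrier (sp_alg TYPE(2))"
proof -
  have mult: "map_matrix cnj (a ** b) = map_matrix cnj a ** map_matrix cnj b" for a b :: "complex^4^4"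
    by (simp add: vec_eq_iff map_matrix_def matrix_matrix_mult_def)
  have diff: "map_matrix cnj (a - b) = map_matrix cnj a - map_matrix cnj b" for a b :: "complex^4^4"
    by (simp add: linear_diff[OF linear_map_cnj])
  have "mono_sqrt CARD(4) (- 1) (J_table 2 :: (nat \<times> complex) list)"
    by (rule mono_sqrt_J_table) simp
  note J = mono_sqrt_square[OF this]
  have "J_conjugation 2 (commutator x y) = conj_by (J_mat 2) (commutator (map_matrix cnj x) (map_matrix cnj y))"
    by (simp add: J_conjugation_def commutator_def mult diff)
  also have "\<dots> = commutator (J_conjugation 2 x) (J_conjugation 2 y)"
    using conj_by_sqrt_hom(4)[OF J] by (simp add: J_conjugation_def J_mat_monomial)
  finally have "J_conjugation 2 (commutator x y) = commutator x y"
    using assms by (simp add: sp_carrier)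
  then show ?thesis
    using assms commutator_in_su[of x "TYPE(4)" y] by (simp add: sp_carrier)
qed

lemma spin5_prod_in_sp:
  fixes i j :: 5
  assumes "i \<noteq> j"
  shows "family spin5' i ** family spin5 j \<in> carrier (sp_alg TYPE(2))"
proof -
  have inv: "\<forall>k<5. \<forall>l<5. mono_conj (- 1) (J_table 2) (mono_map cnj (mono_mul (spin5' ! k) (spin5 ! l))) =
      mono_mul (spin5' ! k) (spin5 ! l)"
    unfolding all_less spin5_eval by (simp add: spin6_eval spin6'_eval table_eval)
  have wf: "mono_wf CARD(4) (mono_mul (spin5' ! index_pos i) (spin5 ! index_pos j))"
  proof -
    have tab: "clifford_table CARD(5) 4 spin5 spin5'"
      by (simp add: clifford_spin5)
    show ?thesis
      using mono_wf_mul[OF clifford_table_wf(2)[OF tab] clifford_table_wf(1)[OF tab]] by simp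
  qed
  have "J_conjugation 2 (family spin5' i ** family spin5 j :: complex^4^4) = family spin5' i ** family spin5 j"
    using inv index_pos_less[of i] index_pos_less[of j] wf
    by (simp add: family_mult clifford_spin5 J_conjugation_monomial)
  moreover have "embed5 i \<noteq> embed5 j"
  proof -
    have "\<forall>k<5. \<forall>l<5. k \<noteq> l \<longrightarrow> iota ! k \<noteq> iota ! l"
      unfolding all_less by (simp add: iota_def)
    then have "iota ! index_pos i \<noteq> iota ! index_pos j"
      using assms index_pos_less[of i] index_pos_less[of j] by simp
    then show ?thesis
      by (metis index_pos_embed5)
  qed
  ultimately show ?thesis
    using spin6_prod_in_su by (simp add: sp_carrier family_spin5)
qed

text \<open>Under the isomorphism with \<open>\<ss>\<oo>(6)\<close> the subalgebra \<open>\<ss>\<pp>(2)\<close> of \<open>\<ss>\<uu>(4)\<close> is the stabiliser of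
  the first basis vector.\<close>

lemma spin5_image: "\<Psi>\<^sub>5 ` carrier (so_alg TYPE(5)) = carrier (sp_alg TYPE(2))"
proof
  show "\<Psi>\<^sub>5 ` carrier (so_alg TYPE(5)) \<subseteq> carrier (sp_alg TYPE(2))"
    using spin_map_in_subspace[where s = "family spin5" and t = "family spin5'", OF subspace_sp spin5_prod_in_sp]
    by blast
  show "carrier (sp_alg TYPE(2)) \<subseteq> \<Psi>\<^sub>5 ` carrier (so_alg TYPE(5))"
  proof
    fix M assume M: "M \<in> carrier (sp_alg TYPE(2))"
    then obtain A where A: "A \<in> carrier (so_alg TYPE(6))" "M = \<Psi>\<^sub>6 A"
      using spin6_image by (auto simp: sp_carrier)
    have D: "mono_sqrt CARD(6) 1 (diag_table 1 5 :: (nat \<times> real) list)"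
      by (rule mono_sqrt_diag_table) simp
    have "so_fix_so_so 1 5 A \<in> carrier (so_alg TYPE(6))"
      using lie_iso_in_carrier[of "so_alg TYPE(6)" "so_alg TYPE(6)" "so_fix_so_so 1 5" A] A
        so_fix_so_so_involution[where 'n = 6, of 1 5] by (simp add: lie_involution_def)
    moreover have "\<Psi>\<^sub>6 (so_fix_so_so 1 5 A) = \<Psi>\<^sub>6 A"
      using M A(2) spin6_sp[of A] by (simp add: sp_carrier su_fix_sp_def)
    ultimately have "so_fix_so_so 1 5 A = A"
      using A(1) spin6_iso by (simp add: lie_iso_def bij_betw_def inj_on_def)
    then have fixed: "conj_by (monomial (diag_table 1 5)) A = A"
      by (simp add: so_fix_so_so_def diag_sign_monomial)
    have "A $ index_at 0 $ j = 0" for j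
    proof (cases "index_pos j = 0")
      case True
      then have "j = index_at 0"
        by (metis index_at_pos)
      then show ?thesis
        using A(1) so_entry[of A "index_at 0" "index_at 0"] by (simp add: so_carrier)
    next
      case False
      have "conj_by (monomial (diag_table 1 5)) A $ index_at 0 $ j = A $ index_at 0 $ j"
        using fixed by simp
      then show ?thesis
        using False index_pos_less[of j] unfolding conj_by_signed_permutation[OF D] by (simp add: diag_table_def sign_table_def)
    qed
    moreover from this have "A $ i $ index_at 0 = 0" for i
      using A(1) so_entry[of A "index_at 0" i] by (simp add: so_carrier)
    ultimately have "\<Psi>\<^sub>6 A = \<Psi>\<^sub>5 (\<chi> i j. A $ embed5 i $ embed5 j)"
      unfolding spin_map_def by (subst sum_embed5, simp, subst sum_embed5, simp) (simp add: family_spin5)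
    moreover have "(\<chi> i j. A $ embed5 i $ embed5 j) \<in> carrier (so_alg TYPE(5))"
    proof -
      have "A $ embed5 j $ embed5 i = - (A $ embed5 i $ embed5 j)" for i j
        by (rule so_entry) (use A(1) in \<open>simp add: so_carrier\<close>)
      note skew = this
      show ?thesis
        unfolding so_carrier vec_eq_iff by (intro allI) (simp add: transpose_def, rule skew)
    qed
    ultimately show "M \<in> \<Psi>\<^sub>5 ` carrier (so_alg TYPE(5))"
      using A(2) by blast
  qed
qed

lemma spin5_iso: "lie_iso (so_alg TYPE(5)) (sp_alg TYPE(2)) \<Psi>\<^sub>5"
  by (subst sp_alg_eq, rule clifford_family.spin_map_lie_iso[OF clifford_family_spin5 _ spin5_image]) simp

lemma sp2_compact_semisimple: "compact_semisimple (sp_alg TYPE(2))"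
proof (subst sp_alg_eq, rule compact_semisimple_if_iso_so)
  show "lie_iso (so_alg TYPE(5)) \<lparr>carrier = carrier (sp_alg TYPE(2)), bracket = commutator\<rparr> \<Psi>\<^sub>5"
    using spin5_iso sp_alg_eq by metis
  show "carrier (sp_alg TYPE(2)) \<subseteq> carrier (su_alg TYPE(4))"
    by (auto simp: sp_carrier)
qed (simp_all add: subspace_sp commutator_in_sp)

lemma sp_fix_sp_sp_monomial:
  "(sp_fix_sp_sp 1 1 :: complex^4^4 \<Rightarrow> complex^4^4) = conj_by (monomial (sign_table 4 {0, 2}))"
proof -
  have eq: "\<forall>k<4. \<forall>l<4. (if k \<noteq> l then 0 else if k mod (1 + 1) < 1 then 1 else - 1 :: complex) =
      (if l = fst (sign_table 4 {0, 2} ! k) then snd (sign_table 4 {0, 2} ! k) else 0)"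
    unfolding all_less by (simp add: table_eval flip: numeral_2_eq_2)
  have "(if i \<noteq> j then 0 else if index_pos i mod (1 + 1) < 1 then 1 else - 1 :: complex) =
      (if index_pos j = fst (sign_table 4 {0, 2} ! index_pos i) then snd (sign_table 4 {0, 2} ! index_pos i) else 0)" for i j :: 4
  proof -
    have "index_pos i < 4" "index_pos j < 4"
      using index_pos_less[of i] index_pos_less[of j] by simp_all
    then show ?thesis
      by (rule eq[rule_format, of "index_pos i" "index_pos j", unfolded index_pos_inj])
  qed
  note entry = this
  show ?thesis
    unfolding sp_fix_sp_sp_def monomial_def
    by (rule arg_cong[where f = conj_by], unfold vec_eq_iff vec_lambda_beta, intro allI, rule entry)
qed

lemma spin5_sp_sp: "sp_fix_sp_sp 1 1 (\<Psi>\<^sub>5 A) = \<Psi>\<^sub>5 (so_fix_so_so 1 4 A)"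
proof -
  have "conj_by (monomial (sign_table 4 {0, 2})) (\<Psi>\<^sub>5 A) = \<Psi>\<^sub>5 (conj_by (monomial (diag_table 1 4)) A)"
  proof (rule spin_map_equivariant_table[where \<epsilon> = 1 and H = "mono_conj 1 (sign_table 4 {0, 2})"])
    show "table_equivariant CARD(5) (mono_conj 1 (sign_table 4 {0, 2})) (diag_table 1 4) spin5 spin5'"
      by (simp add: table_equivariant_def all_less spin5_eval) (simp add: spin6_eval spin6'_eval table_eval)
  qed (simp_all add: clifford_spin5 linear_conj_by_monomial[where \<epsilon> = 1]
      conj_by_monomial[where \<epsilon> = 1]
      mono_sqrt_diag_table mono_sqrt_sign_table)
  then show ?thesis
    unfolding sp_fix_sp_sp_monomial by (simp add: so_fix_so_so_def diag_sign_monomial)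
qed

text \<open>These tables are \<open>K\<^sub>2\<close> and \<open>\<i> diag (1, 1, - 1, - 1)\<close>.  The second one is the quaternionic scalar \<open>i\<close>,
  conjugation by which is the standard involution that fixes \<open>\<uu>(2)\<close>.\<close>

definition quat_k2 :: "(nat \<times> complex) list" where
  "quat_k2 = [(3, - 1), (2, - 1), (1, 1), (0, 1)]"

definition quat_i :: "(nat \<times> complex) list" where
  "quat_i = [(0, \<i>), (1, \<i>), (2, - \<i>), (3, - \<i>)]"

lemma mono_sqrt_quat_k2: "mono_sqrt 4 (- 1) quat_k2"
  unfolding mono_sqrt_def mono_invol_def all_less by (simp add: quat_k2_def)

text \<open>\<open>K\<^sub>2\<close> anticommutes with \<open>K\<^sub>1\<close> and \<open>K\<^sub>3\<close> and commutes with the other three matrices of the family.\<close>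

lemma spin5_k2: "conj_by (monomial quat_k2) (\<Psi>\<^sub>5 A) = \<Psi>\<^sub>5 (so_fix_so_so 2 3 A)"
proof -
  have "conj_by (monomial quat_k2) (\<Psi>\<^sub>5 A) = \<Psi>\<^sub>5 (conj_by (monomial (diag_table 2 3)) A)"
  proof (rule spin_map_equivariant_table[where \<epsilon> = 1 and H = "mono_conj (- 1) quat_k2"])
    show "table_equivariant CARD(5) (mono_conj (- 1) quat_k2) (diag_table 2 3) spin5 spin5'"
      by (simp add: table_equivariant_def all_less spin5_eval) (simp add: spin6_eval spin6'_eval table_eval quat_k2_def)
  qed (simp_all add: clifford_spin5 linear_conj_by_monomial[where \<epsilon> = "- 1"]
      conj_by_monomial[where \<epsilon> = "- 1"]
      mono_sqrt_diag_table mono_sqrt_quat_k2)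
  then show ?thesis
    by (simp add: so_fix_so_so_def diag_sign_monomial)
qed

text \<open>Conjugation by the normalised sum of two anticommuting square roots of \<open>- 1\<close> exchanges them.\<close>

definition X4 :: "complex^4^4" where
  "X4 = (1 / sqrt 2) *\<^sub>R (monomial quat_k2 + monomial quat_i)"

lemma quat_k2_i:
  fixes K Q :: "complex^4^4"
  defines "K \<equiv> monomial quat_k2" and "Q \<equiv> monomial quat_i"
  shows "K ** K = - mat 1" "Q ** Q = - mat 1" "Q ** K = - (K ** Q)"
    "K \<in> carrier (sp_alg TYPE(2))" "Q \<in> carrier (sp_alg TYPE(2))"
proof -
  have wf: "mono_wf 4 quat_k2" "mono_wf 4 quat_i" and len: "length quat_k2 = 4" "length quat_i = 4"
    and inv: "mono_invol 4 quat_k2" "mono_invol 4 quat_i"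
    by (simp_all add: mono_wf_def mono_invol_def quat_k2_def quat_i_def all_less)
  show "K ** K = - mat 1" "Q ** Q = - mat 1" "Q ** K = - (K ** Q)"
    unfolding K_def Q_def
    by (simp_all add: monomial_mult wf len monomial_one monomial_uminus mono_one_eval mono_mul_def)
      (simp_all add: quat_k2_def quat_i_def mono_map_def)
  show "K \<in> carrier (sp_alg TYPE(2))" "Q \<in> carrier (sp_alg TYPE(2))"
    unfolding K_def Q_def sp_carrier su_carrier
    by (simp_all add: adjoint_monomial inv J_conjugation_monomial wf monomial_uminus len trace_monomial sum_lessThan_4)
      (simp_all add: quat_k2_def quat_i_def mono_transpose_def table_eval eval_nat_numeral)
qed

lemma X4: "X4 ** X4 = - mat 1" "X4 \<in> carrier (sp_alg TYPE(2))"
proof -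
  have "X4 ** X4 = (1 / 2) *\<^sub>R (monomial quat_k2 ** monomial quat_k2 + monomial quat_i ** monomial quat_i)"
    using quat_k2_i(3) by (simp add: X4_def matmul_bilinear scaleR_add_right scaleR_right_diff_distrib)
  also have "\<dots> = - mat 1"
    by (simp add: quat_k2_i flip: scaleR_2)
  finally show "X4 ** X4 = - mat 1" .
  show "X4 \<in> carrier (sp_alg TYPE(2))"
    unfolding X4_def by (intro subspace_scale subspace_add subspace_sp quat_k2_i)
qed

text \<open>The scalar \<open>\<i>\<close> and its inverse cancel.\<close>

lemma sp_fix_u_quat_i: "sp_fix_u 2 = conj_by (monomial quat_i :: complex^4^4)"
proof
  fix Z :: "complex^4^4"
  let ?D = "monomial (diag_table 2 2) :: complex^4^4" and ?I = "mat \<i> :: complex^4^4"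
  have comm: "W ** ?I = ?I ** W" for W :: "complex^4^4"
    by (simp add: vec_eq_iff matmul_entry mat_def if_distrib[of "(*) x" for x] if_distrib[of "\<lambda>x. x * y" for y]
        mult.commute cong: if_cong)
  have II: "?I ** ?I = - mat 1"
    by (simp add: vec_eq_iff matmul_entry) (simp add: mat_def if_distrib[of "(*) x" for x] cong: if_cong)
  have "monomial quat_i = ?I ** ?D"
  proof -
    have "?I = monomial (map (\<lambda>r. (r, \<i>)) [0..<4])"
      using index_pos_less[where 'n = 4] by (simp add: vec_eq_iff mat_def monomial_def)
    then show ?thesis
      by (simp add: monomial_mult mono_wf_def diag_table_def sign_table_def upt_eval mono_mul_def quat_i_def)
  qed
  then have "conj_by (monomial quat_i) Z = - (?I ** ?D ** Z ** (?I ** ?D))"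
    using conj_by_sqrt[of "monomial quat_i :: complex^4^4" "- 1"] quat_k2_i(2) by (simp add: matmul_bilinear)
  also have "?I ** ?D ** Z ** (?I ** ?D) = ?I ** ((?D ** Z) ** ?I) ** ?D"
    by (simp only: matrix_mul_assoc)
  also have "\<dots> = ?I ** (?I ** (?D ** Z ** ?D))"
    unfolding comm[of "?D ** Z"] by (simp only: matrix_mul_assoc)
  also have "\<dots> = - (?D ** Z ** ?D)"
    unfolding matrix_mul_assoc[of ?I ?I] II by (simp add: matmul_bilinear)
  finally have "conj_by (monomial quat_i) Z = ?D ** Z ** ?D"
    by simp
  moreover have "?D ** ?D = 1 *\<^sub>R mat 1"
    by (rule mono_sqrt_square[OF mono_sqrt_diag_table]) simp
  ultimately show "sp_fix_u 2 Z = conj_by (monomial quat_i) Z"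
    using conj_by_sqrt[of ?D 1] by (simp add: sp_fix_u_def diag_sign_monomial)
qed

lemma X4_intertwine: "sp_fix_u 2 (conj_by X4 Z) = conj_by X4 (conj_by (monomial quat_k2) Z)"
proof -
  have "monomial quat_i ** X4 = X4 ** monomial quat_k2" "X4 ** monomial quat_i = monomial quat_k2 ** X4"
    using quat_k2_i(3) by (simp_all add: X4_def matmul_bilinear quat_k2_i(1,2) add.commute)
  then show ?thesis
    unfolding sp_fix_u_quat_i
    by (intro conj_by_intertwine[where \<epsilon> = "- 1" and \<delta> = "- 1"]) (simp_all add: quat_k2_i X4)
qed

lemma triad_so5_sp2:
  "(so_alg TYPE(5), so_fix_so_so 1 4, so_fix_so_so 2 3) \<sim>\<^sub>t
   (sp_alg TYPE(2), sp_fix_sp_sp 1 1, sp_fix_u 2)"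
proof (rule triad_equivI[OF _ _ spin5_iso])
  have so: "compact_semisimple (so_alg TYPE(5))"
    by (rule so_compact_semisimple) simp
  have inv: "lie_involution (so_alg TYPE(5)) (so_fix_so_so 1 4)" "lie_involution (so_alg TYPE(5)) (so_fix_so_so 2 3)"
    by (simp_all add: so_fix_so_so_involution)
  then show "compact_symmetric_triad (so_alg TYPE(5), so_fix_so_so 1 4, so_fix_so_so 2 3)"
    using so by (simp add: compact_symmetric_triad_def)
  have sp: "lie_algebra (sp_alg TYPE(2))"
    using sp2_compact_semisimple by (simp add: compact_semisimple_def)
  have "conj_by X4 Z \<in> carrier (sp_alg TYPE(2))" if Z: "Z \<in> carrier (sp_alg TYPE(2))" for Z
  proof -
    have "conj_by X4 Z = Z + (1 / 2) *\<^sub>R commutator X4 (commutator X4 Z)"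
      by (simp add: conj_by_sqrt[of X4 "- 1"] X4(1) commutator_twice)
    then show ?thesis
      using Z X4(2) by (simp add: subspace_add subspace_scale subspace_sp commutator_in_sp)
  qed
  then have aut: "lie_aut (sp_alg TYPE(2)) (conj_by X4)"
    using conj_by_lie_aut[of X4 "- 1" "carrier (sp_alg TYPE(2))"] X4(1) sp_alg_eq[of "TYPE(2)"] by simp
  then show "bij_betw (conj_by X4) (carrier (sp_alg TYPE(2))) (carrier (sp_alg TYPE(2)))"
    by (simp add: lie_iso_def)
  show "conj_by X4 \<in> Int_group (sp_alg TYPE(2))"
    by (rule conj_by_inner[OF X4 subspace_sp]) (simp add: sp_alg_def)
  show 1: "sp_fix_sp_sp 1 1 (\<Psi>\<^sub>5 x) = \<Psi>\<^sub>5 (so_fix_so_so 1 4 x)" for x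
    by (rule spin5_sp_sp)
  show 2: "sp_fix_u 2 (conj_by X4 (\<Psi>\<^sub>5 x)) = conj_by X4 (\<Psi>\<^sub>5 (so_fix_so_so 2 3 x))" for x
    by (simp add: X4_intertwine spin5_k2)
  have "lie_involution (sp_alg TYPE(2)) (sp_fix_sp_sp 1 1)"
    by (rule lie_involution_transport[OF spin5_iso so_lie_algebra sp inv(1) 1])
  moreover have "lie_involution (sp_alg TYPE(2)) (sp_fix_u 2)"
    by (rule lie_involution_transport[OF lie_iso_comp[OF spin5_iso aut] so_lie_algebra sp inv(2)]) (simp add: 2)
  ultimately show "compact_symmetric_triad (sp_alg TYPE(2), sp_fix_sp_sp 1 1, sp_fix_u 2)"
    using sp2_compact_semisimple by (simp add: compact_symmetric_triad_def)
qed

theorem corollary5p23: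
  shows
    "((so_alg TYPE(8), so_fix_u 4, so_fix_so_so 4 4) \<sim>\<^sub>t
         (so_alg TYPE(8), so_fix_so_so 2 6, so_fix_so_so 4 4)) \<and>
     ((so_alg TYPE(5), so_fix_so_so 1 4, so_fix_so_so 2 3) \<sim>\<^sub>t
         (sp_alg TYPE(2), sp_fix_sp_sp 1 1, sp_fix_u 2)) \<and>
     ((su_alg TYPE(4), su_fix_so, su_fix_sp 2) \<sim>\<^sub>t
         (so_alg TYPE(6), so_fix_so_so 3 3, so_fix_so_so 1 5)) \<and>
     ((su_alg TYPE(4), su_fix_so, su_fix_s_u_u 2 2) \<sim>\<^sub>t
         (so_alg TYPE(6), so_fix_so_so 3 3, so_fix_so_so 2 4)) \<and>
     ((su_alg TYPE(4), su_fix_so, su_fix_s_u_u 1 3) \<sim>\<^sub>t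
         (so_alg TYPE(6), so_fix_so_so 3 3, so_fix_u 3)) \<and>
     ((su_alg TYPE(4), su_fix_sp 2, su_fix_s_u_u 2 2) \<sim>\<^sub>t
         (so_alg TYPE(6), so_fix_so_so 1 5, so_fix_so_so 2 4)) \<and>
     ((su_alg TYPE(4), su_fix_sp 2, su_fix_s_u_u 1 3) \<sim>\<^sub>t
         (so_alg TYPE(6), so_fix_so_so 1 5, so_fix_u 3)) \<and>
     ((su_alg TYPE(4), su_fix_s_u_u 2 2, su_fix_s_u_u 1 3) \<sim>\<^sub>t
         (so_alg TYPE(6), so_fix_so_so 2 4, so_fix_u 3))"
  using triad_so8 triad_so5_sp2 triad_su4_so_sp triad_su4_so_s_u2_u2 triad_su4_so_s_u1_u3
    triad_su4_sp_s_u2_u2 triad_su4_sp_s_u1_u3 triad_su4_s_u2_u2_s_u1_u3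
  by (intro conjI)

end
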